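(* Let $G\subset\mathbb{R}^N$ be a bounded open domain and $T>0$. Let $\varphi:G\times\mathbb{R}\to[0,+\infty)$ be a measurable-convex integrand with $\varphi(x,0)=0$ for each $x\in G$, and let $\bar\beta(x,\cdot)=\partial\varphi(x,\cdot)$. Assume that for each $C>0$ the function $M_C(x)=\sup\{|u|:\ u\in\bar\beta(x,v),\ |v|\le C\}$ belongs to $L^2(G)$. Let $A:\mathrm{Dom}(A)\subset L^1(G)\to L^1(G)$ be a linear operator such that: (a) $\mathrm{Dom}(A)$ is dense in $L^1(G)$ and $(I+\lambda A)^{-1}$ is a contraction on $L^1(G)$ for each $\lambda>0$; (b) there is a $c>0$ such that $c\|v\|_{L^1}\le\|Av\|_{L^1}$ for all $v\in\mathrm{Dom}(A)$; (c) $\sup_G (I+\lambda A)^{-1}f\le(\sup_G f)^+$ for each $f\in L^1(G)$ and $\lambda>0$. Let $\mathcal{A}$ be the relation on $L^1(G)$ defined by: $f\in\mathcal{A}(u)$ iff $u,f\in L^1(G)$ and there is $\chi\in\mathrm{Dom}(A)$ with $A\chi=f$ and $u(x)\in\bar\beta(x,\chi(x))$ for a.e. $x\in G$. For $i=1,2$ let $u_i$ be the $C^0$-solution of $u_i'(t)+\mathcal{A}u_i(t)\ni F_i(t)$, $0<t<T$, with initial value $u_i(0)\in\overline{\mathrm{Dom}(\mathcal{A})}$ and $F_i\in L^1(0,T;L^1(G))$. Then for $0\le t\le T$ $$\|(u_1(t)-u_2(t))^+\|_{L^1}\le\|(u_1(0)-u_2(0))^+\|_{L^1}+\int_0^t\|(F_1(s)-F_2(s))^+\|_{L^1}\,ds,$$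 $$\|(u_1(t)-u_2(t))^-\|_{L^1}\le\|(u_1(0)-u_2(0))^-\|_{L^1}+\int_0^t\|(F_1(s)-F_2(s))^-\|_{L^1}\,ds,$$ $$\|u_1(t)-u_2(t)\|_{L^1}\le\|u_1(0)-u_2(0)\|_{L^1}+\int_0^t\|F_1(s)-F_2(s)\|_{L^1}\,ds.$$
   Context: A function $\varphi:G\times\mathbb{R}\to(-\infty,+\infty]$ is a measurable-convex integrand if for each $x\in G$ the function $\varphi(x,\cdot)$ is proper, lower semicontinuous and convex, and for each $\xi\in\mathbb{R}$ the function $x\mapsto\varphi(x,\xi)$ is measurable. The subgradient is taken in the second variable: $u^*\in\partial\varphi(x,v)$ iff $u^*(w-v)\le\varphi(x,w)-\varphi(x,v)$ for all $w\in\mathbb{R}$. "Contraction" means nonexpansive, and in (a) the inverse $(I+\lambda A)^{-1}$ is defined on all of $L^1(G)$. $\sup_G$ is the essential supremum; $r^+=\max(r,0)$, $r^-=\max(-r,0)$. $\mathrm{Dom}(\mathcal{A})=\{u:\mathcal{A}(u)\neq\emptyset\}$, and the closure is in $L^1(G)$. With $X=L^1(G)$: an $\varepsilon$-solution of $u'+\mathcal{A}u\ni F$ on $[0,T]$ consists of a discretization $\mathcal{D}=\{0=t_0<t_1<\dots<t_n=T;\ F_1,\dots,F_n\in X\}$ and a step function $s$ with $s(t_0)=s_0$ and $s(t)=s_j$ for $t\in(t_{j-1},t_j]$, such that $t_j-t_{j-1}\le\varepsilon$ for $1\le j\le n$, $\sum_{j=1}^n\int_{t_{j-1}}^{t_j}\|F(t)-F_j\|\,dt<\varepsilon$,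 and $\frac{s_j-s_{j-1}}{t_j-t_{j-1}}+\mathcal{A}(s_j)\ni F_j$ for $1\le j\le n$ (here $F_j$ denotes the discretized values of the right-hand side $F$). A $C^0$-solution with initial value $u_0$ is a function $u\in C([0,T];X)$ with $u(0)=u_0$ such that for each $\varepsilon>0$ there is an $\varepsilon$-solution $\mathcal{D},s$ with $\|u(t)-s(t)\|\le\varepsilon$ for all $t\in[0,T]$. For data as in the claim, the $C^0$-solution exists and is unique. *)

theory Defs
  imports "HOL-Analysis.Analysis" "HOL-Probability.Essential_Supremum"
begin

definition l1_rel :: "('a::euclidean_space \<Rightarrow> real) \<Rightarrow> ('a \<Rightarrow> real) \<Rightarrow> bool" where
  "l1_rel f g \<longleftrightarrow> integrable lebesgue f \<and> integrable lebesgue g \<and> (AE x in lebesgue. f x = g x)"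

lemma part_equivp_l1_rel: "part_equivp l1_rel"
proof (rule part_equivpI)
  show "\<exists>f. l1_rel f f"
    by (rule exI[of _ "\<lambda>_. 0"]) (simp add: l1_rel_def)
  show "symp l1_rel"
    by (rule sympI) (auto simp: l1_rel_def elim: eventually_mono)
  show "transp l1_rel"
    by (rule transpI) (auto simp: l1_rel_def)
qed

quotient_type (overloaded) 'a l1 = "'a::euclidean_space \<Rightarrow> real" / partial: l1_rel
  morphisms l1_fun l1_class
  by (rule part_equivp_l1_rel)

instantiation l1 :: (euclidean_space) real_vector
begin
lift_definition zero_l1 :: "'a l1" is "\<lambda>_. 0" by (simp add: l1_rel_def)
lift_definition plus_l1 :: "'a l1 \<Rightarrow> 'a l1 \<Rightarrow> 'a l1" is "\<lambda>f g x. f x + g x"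
  by (auto simp: l1_rel_def elim: eventually_elim2)
lift_definition uminus_l1 :: "'a l1 \<Rightarrow> 'a l1" is "\<lambda>f x. - f x"
  by (auto simp: l1_rel_def)
lift_definition minus_l1 :: "'a l1 \<Rightarrow> 'a l1 \<Rightarrow> 'a l1" is "\<lambda>f g x. f x - g x"
  by (auto simp: l1_rel_def elim: eventually_elim2)
lift_definition scaleR_l1 :: "real \<Rightarrow> 'a l1 \<Rightarrow> 'a l1" is "\<lambda>c f x. c * f x"
  by (auto simp: l1_rel_def elim: eventually_mono)
instance
  by standard (transfer; auto simp: l1_rel_def algebra_simps)+
end

instantiation l1 :: (euclidean_space) real_normed_vector
begin
lift_definition norm_l1 :: "'a l1 \<Rightarrow> real" is "\<lambda>f. \<integral>x. \<bar>f x\<bar> \<partial>lebesgue"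
  by (auto simp: l1_rel_def intro!: integral_cong_AE)
definition "sgn (f::'a l1) = f /\<^sub>R norm f"
definition "dist (f::'a l1) g = norm (f - g)"
definition "(uniformity :: ('a l1 \<times> 'a l1) filter) = (INF e\<in>{0<..}. principal {(x, y). dist x y < e})"
definition "open (U::'a l1 set) \<longleftrightarrow>
  (\<forall>x\<in>U. \<forall>\<^sub>F (x', y) in uniformity. x' = x \<longrightarrow> y \<in> U)"
instance
proof
  fix f g :: "'a l1" and a :: real
  show "norm f = 0 \<longleftrightarrow> f = 0"
    by transfer (auto simp: l1_rel_def integral_nonneg_eq_0_iff_AE)
  show "norm (f + g) \<le> norm f + norm g"
  proof transfer
    fix f g :: "'a \<Rightarrow> real"
    assume "l1_rel f f" "l1_rel g g"
    then have i: "integrable lebesgue f" "integrable lebesgue g" by (auto simp: l1_rel_def)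
    have "(\<integral>x. \<bar>f x + g x\<bar> \<partial>lebesgue) \<le> (\<integral>x. \<bar>f x\<bar> + \<bar>g x\<bar> \<partial>lebesgue)"
      using i by (intro integral_mono) auto
    also have "\<dots> = (\<integral>x. \<bar>f x\<bar> \<partial>lebesgue) + (\<integral>x. \<bar>g x\<bar> \<partial>lebesgue)"
      using i by (intro Bochner_Integration.integral_add) auto
    finally show "(\<integral>x. \<bar>f x + g x\<bar> \<partial>lebesgue) \<le> (\<integral>x. \<bar>f x\<bar> \<partial>lebesgue) + (\<integral>x. \<bar>g x\<bar> \<partial>lebesgue)" .
  qed
  show "norm (a *\<^sub>R f) = \<bar>a\<bar> * norm f"
    by transfer (auto simp: l1_rel_def abs_mult)
qed (simp_all add: sgn_l1_def dist_l1_def uniformity_l1_def open_l1_def)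
end

lemma l1_fun_integrable: "integrable lebesgue (l1_fun f)"
  using Quotient3_rep_reflp[OF Quotient3_l1, of f] by (simp add: l1_rel_def)

lemma l1_class_l1_fun: "l1_class (l1_fun f) = f"
  by (rule Quotient3_abs_rep[OF Quotient3_l1])

lemma l1_class_eq_iff:
  "integrable lebesgue f \<Longrightarrow> integrable lebesgue g \<Longrightarrow>
    l1_class f = l1_class g \<longleftrightarrow> (AE x in lebesgue. f x = g x)"
  using Quotient3_rel[OF Quotient3_l1, of f g] by (auto simp: l1_rel_def)

lemma l1_fun_l1_class: "integrable lebesgue f \<Longrightarrow> AE x in lebesgue. l1_fun (l1_class f) x = f x"
  by (subst l1_class_eq_iff[symmetric]) (auto simp: l1_fun_integrable l1_class_l1_fun)

lemma l1_class_add: "integrable lebesgue f \<Longrightarrow> integrable lebesgue g \<Longrightarrow>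
    l1_class f + l1_class g = l1_class (\<lambda>x. f x + g x)"
  by (rule plus_l1.abs_eq) (auto simp: l1_rel_def)

lemma l1_class_diff: "integrable lebesgue f \<Longrightarrow> integrable lebesgue g \<Longrightarrow>
    l1_class f - l1_class g = l1_class (\<lambda>x. f x - g x)"
  by (rule minus_l1.abs_eq) (auto simp: l1_rel_def)

lemma l1_class_scaleR: "integrable lebesgue f \<Longrightarrow> c *\<^sub>R l1_class f = l1_class (\<lambda>x. c * f x)"
  by (rule scaleR_l1.abs_eq) (auto simp: l1_rel_def)

lemma norm_l1_class: "integrable lebesgue f \<Longrightarrow> norm (l1_class f) = (\<integral>x. \<bar>f x\<bar> \<partial>lebesgue)"
  by (rule norm_l1.abs_eq) (auto simp: l1_rel_def)

lemma dist_l1_class: "integrable lebesgue f \<Longrightarrow> integrable lebesgue g \<Longrightarrow>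
    dist (l1_class f) (l1_class g) = (\<integral>x. \<bar>f x - g x\<bar> \<partial>lebesgue)"
  by (simp add: dist_norm l1_class_diff norm_l1_class)


lemma l1_fun_add: "AE x in lebesgue. l1_fun (f + g) x = l1_fun f x + l1_fun g x"
  using l1_fun_l1_class[of "\<lambda>x. l1_fun f x + l1_fun g x"]
  by (simp add: l1_fun_integrable l1_class_add[symmetric] l1_class_l1_fun)

lemma l1_fun_diff: "AE x in lebesgue. l1_fun (f - g) x = l1_fun f x - l1_fun g x"
  using l1_fun_l1_class[of "\<lambda>x. l1_fun f x - l1_fun g x"]
  by (simp add: l1_fun_integrable l1_class_diff[symmetric] l1_class_l1_fun)

lemma l1_fun_scaleR: "AE x in lebesgue. l1_fun (c *\<^sub>R f) x = c * l1_fun f x"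
  using l1_fun_l1_class[of "\<lambda>x. c * l1_fun f x"]
  by (simp add: l1_fun_integrable l1_class_scaleR[symmetric] l1_class_l1_fun)

instance l1 :: (euclidean_space) banach
proof
  fix X :: "nat \<Rightarrow> 'a l1"
  assume "Cauchy X"
  define f where "f n = l1_fun (X n)" for n
  have [simp]: "integrable lebesgue (f n)" for n
    by (simp add: f_def l1_fun_integrable)
  have [measurable]: "f n \<in> borel_measurable lebesgue" for n
    by (rule borel_measurable_integrable) simp
  have X: "X n = l1_class (f n)" for n
    by (simp add: f_def l1_class_l1_fun)
  have cauchy: "\<exists>N. \<forall>i\<ge>N. \<forall>j\<ge>N. (\<integral>x. norm (f i x - f j x) \<partial>lebesgue) < e" if "e > 0" for e
    using metric_CauchyD[OF \<open>Cauchy X\<close> that] by (simp add: X dist_l1_class)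
  obtain r where r: "strict_mono r" and ae: "AE x in lebesgue. Cauchy (\<lambda>i. f (r i) x)"
    using cauchy_L1_AE_cauchy_subseq[of lebesgue f, OF _ cauchy] by auto
  define g where "g x = lim (\<lambda>i. f (r i) x)" for x
  have [measurable]: "g \<in> borel_measurable lebesgue"
    unfolding g_def by measurable
  have bound: "(\<integral>\<^sup>+x. ennreal \<bar>f n x - g x\<bar> \<partial>lebesgue) \<le> ennreal e"
    if N: "\<forall>i\<ge>N. \<forall>j\<ge>N. (\<integral>x. norm (f i x - f j x) \<partial>lebesgue) < e" and "n \<ge> N" for n N e
  proof -
    have "(\<integral>\<^sup>+x. ennreal \<bar>f n x - g x\<bar> \<partial>lebesgue)
        = (\<integral>\<^sup>+x. liminf (\<lambda>i. ennreal \<bar>f n x - f (r i) x\<bar>) \<partial>lebesgue)"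
    proof (rule nn_integral_cong_AE, use ae in eventually_elim)
      fix x assume "Cauchy (\<lambda>i. f (r i) x)"
      then have "(\<lambda>i. f (r i) x) \<longlonglongrightarrow> g x"
        by (simp add: g_def Cauchy_convergent_iff convergent_LIMSEQ_iff)
      then have "(\<lambda>i. ennreal \<bar>f n x - f (r i) x\<bar>) \<longlonglongrightarrow> ennreal \<bar>f n x - g x\<bar>"
        by (intro tendsto_intros) simp_all
      then show "ennreal \<bar>f n x - g x\<bar> = liminf (\<lambda>i. ennreal \<bar>f n x - f (r i) x\<bar>)"
        by (intro lim_imp_Liminf[symmetric]) simp_all
    qed
    also have "\<dots> \<le> liminf (\<lambda>i. \<integral>\<^sup>+x. ennreal \<bar>f n x - f (r i) x\<bar> \<partial>lebesgue)"
      by (rule nn_integral_liminf) measurable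
    also have "\<dots> \<le> liminf (\<lambda>i. ennreal e)"
    proof (rule Liminf_mono, rule eventually_sequentiallyI[of N])
      fix i assume "N \<le> i"
      then have "N \<le> r i"
        using seq_suble[OF r, of i] by linarith
      then have "(\<integral>x. \<bar>f n x - f (r i) x\<bar> \<partial>lebesgue) < e"
        using N \<open>n \<ge> N\<close> by auto
      then show "(\<integral>\<^sup>+x. ennreal \<bar>f n x - f (r i) x\<bar> \<partial>lebesgue) \<le> ennreal e"
        by (subst nn_integral_eq_integral) (auto intro: ennreal_leI)
    qed
    also have "\<dots> = ennreal e"
      by (simp add: Liminf_const)
    finally show ?thesis .
  qed
  have g: "integrable lebesgue g"
  proof -
    obtain N where N: "\<forall>i\<ge>N. \<forall>j\<ge>N. (\<integral>x. norm (f i x - f j x) \<partial>lebesgue) < 1"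
      using cauchy[of 1] by auto
    have "(\<integral>\<^sup>+x. ennreal \<bar>f N x - g x\<bar> \<partial>lebesgue) < \<infinity>"
      using bound[OF N order_refl] by (simp add: le_less_trans[of _ 1])
    then have "integrable lebesgue (\<lambda>x. f N x - g x)"
      by (intro integrableI_bounded) (simp_all, measurable)
    from Bochner_Integration.integrable_diff[OF _ this, of "f N"] show ?thesis
      by simp
  qed
  have "X \<longlonglongrightarrow> l1_class g"
  proof (rule metric_LIMSEQ_I)
    fix e :: real assume "e > 0"
    obtain N where N: "\<forall>i\<ge>N. \<forall>j\<ge>N. (\<integral>x. norm (f i x - f j x) \<partial>lebesgue) < e/2"
      using cauchy[of "e/2"] \<open>e > 0\<close> by auto
    have "dist (X n) (l1_class g) < e" if "n \<ge> N" for n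
    proof -
      have "ennreal (\<integral>x. \<bar>f n x - g x\<bar> \<partial>lebesgue) \<le> ennreal (e/2)"
        using bound[OF N that] g by (subst (asm) nn_integral_eq_integral) auto
      then show ?thesis
        using \<open>e > 0\<close> g by (simp add: X dist_l1_class)
    qed
    then show "\<exists>N. \<forall>n\<ge>N. dist (X n) (l1_class g) < e"
      by blast
  qed
  then show "convergent X"
    by (rule convergentI)
qed

lemma tendsto_l1_class_dominated:
  fixes f :: "'a::euclidean_space \<Rightarrow> real"
  assumes s: "\<And>i. integrable lebesgue (s i)" and f: "integrable lebesgue f"
    and w: "integrable lebesgue w"
    and lim: "\<And>x. (\<lambda>i. s i x) \<longlonglongrightarrow> f x" and bnd: "\<And>i x. \<bar>s i x\<bar> \<le> w x"
  shows "(\<lambda>i. l1_class (s i)) \<longlonglongrightarrow> l1_class f"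
proof -
  have [measurable]: "f \<in> borel_measurable lebesgue" "\<And>i. s i \<in> borel_measurable lebesgue"
    using s f by auto
  have "(\<lambda>i. \<integral>x. \<bar>s i x - f x\<bar> \<partial>lebesgue) \<longlonglongrightarrow> (\<integral>x. 0 \<partial>(lebesgue :: 'a measure))"
  proof (rule integral_dominated_convergence[where f = "\<lambda>_. 0" and s = "\<lambda>i x. \<bar>s i x - f x\<bar>" and w = "\<lambda>x. w x + \<bar>f x\<bar>"])
    show "integrable lebesgue (\<lambda>x. w x + \<bar>f x\<bar>)"
      using w f by auto
    show "AE x in lebesgue. (\<lambda>i. \<bar>s i x - f x\<bar>) \<longlonglongrightarrow> 0"
    proof (rule AE_I2)
      fix x
      show "(\<lambda>i. \<bar>s i x - f x\<bar>) \<longlonglongrightarrow> 0"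
        using tendsto_rabs[OF tendsto_diff[OF lim[of x] tendsto_const[of "f x"]]] by simp
    qed
    show "AE x in lebesgue. norm \<bar>s i x - f x\<bar> \<le> w x + \<bar>f x\<bar>" for i
    proof (rule AE_I2)
      fix x
      show "norm \<bar>s i x - f x\<bar> \<le> w x + \<bar>f x\<bar>"
        using bnd[of i x] by auto
    qed
  qed measurable
  then have "(\<lambda>i. dist (l1_class (s i)) (l1_class f)) \<longlonglongrightarrow> 0"
    using s f by (simp add: dist_l1_class)
  then show ?thesis
    by (rule tendsto_dist_iff[THEN iffD2])
qed

lemma l1_indicator_approx_open:
  fixes A :: "'a::euclidean_space set"
  assumes A: "A \<in> lmeasurable" and "e > 0"
  obtains U where "open U" "U \<in> lmeasurable"
    "dist (l1_class (indicator U)) (l1_class (indicator A)) < e"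
proof -
  from A have "A \<in> sets lebesgue" by auto
  then obtain U where U: "open U" "A \<subseteq> U" "U - A \<in> lmeasurable" "emeasure lebesgue (U - A) < ennreal e"
    using sets_lebesgue_outer_open \<open>e > 0\<close> by blast
  have "U = A \<union> (U - A)" using U by auto
  then have Um: "U \<in> lmeasurable"
    using fmeasurable.Un[OF A U(3)] by simp
  have eq: "\<bar>indicator U x - indicator A x\<bar> = (indicator (U - A) x :: real)" for x
    using U(2) by (auto simp: indicator_def)
  have "dist (l1_class (indicator U)) (l1_class (indicator A)) = measure lebesgue (U - A)"
    using A Um U(3) by (subst dist_l1_class) (auto simp: eq fmeasurable_def)
  also have "\<dots> < e"
    using U(3,4) by (simp add: emeasure_eq_measure2 \<open>e > 0\<close> ennreal_less_iff)
  finally show ?thesis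
    using that U(1) Um by blast
qed

lemma countable_dense_l1: "\<exists>D :: 'a::euclidean_space l1 set. countable D \<and> closure D = UNIV"
proof -
  obtain \<B> :: "'a set set" where \<B>: "countable \<B>" "topological_basis \<B>"
    using ex_countable_basis by blast
  define K where "K = (\<lambda>F. l1_class (indicator (\<Union>F) :: 'a \<Rightarrow> real)) ` {F. finite F \<and> F \<subseteq> \<B>}"
  have K: "countable K"
    unfolding K_def using \<B>(1) by (intro countable_image countable_Collect_finite_subset)
  define D where "D = (\<lambda>l. \<Sum>(q, b)\<leftarrow>l. real_of_rat q *\<^sub>R b) ` lists (UNIV \<times> K)"
  have "countable D"
    unfolding D_def using K by (intro countable_image countable_lists) auto
  have D_add: "a + b \<in> D" if "a \<in> D" "b \<in> D" for a b
  proof -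
    from that obtain l m where "l \<in> lists (UNIV \<times> K)" "a = (\<Sum>(q, b)\<leftarrow>l. real_of_rat q *\<^sub>R b)"
      "m \<in> lists (UNIV \<times> K)" "b = (\<Sum>(q, b)\<leftarrow>m. real_of_rat q *\<^sub>R b)"
      unfolding D_def by auto
    then show ?thesis
      unfolding D_def by (intro image_eqI[where x = "l @ m"]) auto
  qed
  have D_scale: "real_of_rat p *\<^sub>R a \<in> D" if "a \<in> D" for a p
  proof -
    from that obtain l where l: "l \<in> lists (UNIV \<times> K)" "a = (\<Sum>(q, b)\<leftarrow>l. real_of_rat q *\<^sub>R b)"
      unfolding D_def by auto
    have "real_of_rat p *\<^sub>R (\<Sum>(q, b)\<leftarrow>l. real_of_rat q *\<^sub>R b)
        = (\<Sum>(q, b)\<leftarrow>map (\<lambda>(q, b). (p * q, b)) l. real_of_rat q *\<^sub>R b)"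
      by (induction l) (auto simp: scaleR_add_right of_rat_mult)
    moreover have "map (\<lambda>(q, b). (p * q, b)) l \<in> lists (UNIV \<times> K)"
      using l(1) by auto
    ultimately show ?thesis
      unfolding D_def l(2) by blast
  qed
  have K_D: "K \<subseteq> D"
  proof
    fix k assume "k \<in> K"
    then show "k \<in> D"
      unfolding D_def by (intro image_eqI[where x = "[(1, k)]"]) auto
  qed
  have C_add: "a + b \<in> closure D" if "a \<in> closure D" "b \<in> closure D" for a b
  proof -
    from that obtain s t where st: "\<forall>n. s n \<in> D" "s \<longlonglongrightarrow> a" "\<forall>n. t n \<in> D" "t \<longlonglongrightarrow> b"
      unfolding closure_sequential by blast
    then have "(\<lambda>n. s n + t n) \<longlonglongrightarrow> a + b" "\<forall>n. s n + t n \<in> D"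
      by (auto intro: tendsto_add D_add)
    then show ?thesis
      unfolding closure_sequential by (intro exI[of _ "\<lambda>n. s n + t n"]) simp
  qed
  have C_scale: "c *\<^sub>R a \<in> closure D" if "a \<in> closure D" for a c
  proof -
    have ex: "\<exists>q. dist (real_of_rat q) c < 1 / real (Suc n)" for n
    proof -
      obtain q where "c < real_of_rat q" "real_of_rat q < c + 1 / real (Suc n)"
        using of_rat_dense[of c "c + 1 / real (Suc n)"] by auto
      then have "\<bar>real_of_rat q - c\<bar> < 1 / real (Suc n)"
        by linarith
      then show ?thesis
        unfolding dist_real_def by (rule exI)
    qed
    define q where "q n = (SOME q. dist (real_of_rat q) c < 1 / real (Suc n))" for n
    have q: "dist (real_of_rat (q n)) c < 1 / real (Suc n)" for n
      unfolding q_def by (rule someI_ex) (rule ex)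
    have q_le: "dist (real_of_rat (q n)) c \<le> inverse (real (Suc n))" for n
      using q[of n] unfolding inverse_eq_divide by (rule less_imp_le)
    have "(\<lambda>n. dist (real_of_rat (q n)) c) \<longlonglongrightarrow> 0"
    proof (rule tendsto_sandwich[OF _ _ tendsto_const LIMSEQ_inverse_real_of_nat])
      show "\<forall>\<^sub>F n in sequentially. 0 \<le> dist (real_of_rat (q n)) c"
        by (rule always_eventually) (rule allI, rule zero_le_dist)
      show "\<forall>\<^sub>F n in sequentially. dist (real_of_rat (q n)) c \<le> inverse (real (Suc n))"
        by (rule always_eventually) (rule allI, rule q_le)
    qed
    then have lim: "(\<lambda>n. real_of_rat (q n)) \<longlonglongrightarrow> c"
      by (rule tendsto_dist_iff[THEN iffD2])
    from that obtain s where s: "\<forall>n. s n \<in> D" "s \<longlonglongrightarrow> a"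
      unfolding closure_sequential by blast
    then have "(\<lambda>n. real_of_rat (q n) *\<^sub>R s n) \<longlonglongrightarrow> c *\<^sub>R a" "\<forall>n. real_of_rat (q n) *\<^sub>R s n \<in> D"
      by (auto intro: tendsto_scaleR lim D_scale)
    then show ?thesis
      unfolding closure_sequential by (intro exI[of _ "\<lambda>n. real_of_rat (q n) *\<^sub>R s n"]) simp
  qed
  have C_lim: "a \<in> closure D" if "s \<longlonglongrightarrow> a" "\<And>n. s n \<in> closure D" for a s
    using that closed_sequentially[OF closed_closure] by blast
  have C_open: "l1_class (indicator U) \<in> closure D" if U: "open U" "U \<in> lmeasurable" for U
  proof -
    define \<B>' where "\<B>' = {B\<in>\<B>. B \<subseteq> U}"
    have "countable \<B>'" unfolding \<B>'_def using \<B>(1) by simp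
    have \<B>'_U: "U = \<Union>\<B>'"
    proof
      show "U \<subseteq> \<Union>\<B>'"
      proof
        fix x assume "x \<in> U"
        obtain B where "B \<in> \<B>" "x \<in> B" "B \<subseteq> U"
          using topological_basisE[OF \<B>(2) U(1) \<open>x \<in> U\<close>] .
        then show "x \<in> \<Union>\<B>'"
          unfolding \<B>'_def by blast
      qed
      show "\<Union>\<B>' \<subseteq> U"
        unfolding \<B>'_def by blast
    qed
    show ?thesis
    proof (cases "\<B>' = {}")
      case True
      then have "U = \<Union>{}" using \<B>'_U by simp
      then have "l1_class (indicator U) \<in> K"
        unfolding K_def by (intro image_eqI[where x = "{}"]) auto
      then show ?thesis
        using K_D closure_subset by (meson subsetD)
    next
      case False
      define E where "E = from_nat_into \<B>'"
      have E: "range E = \<B>'"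
        unfolding E_def using False \<open>countable \<B>'\<close> by (rule range_from_nat_into)
      have op: "open (E i)" for i
        using topological_basis_open[OF \<B>(2), of "E i"] rangeI[of E i]
        unfolding E \<B>'_def by simp
      define V where "V n = \<Union>(E ` {..<n})" for n
      have V: "open (V n)" "V n \<subseteq> U" for n
      proof -
        show "open (V n)"
          unfolding V_def using op by (intro open_UN) simp
        show "V n \<subseteq> U"
          unfolding V_def \<B>'_U E[symmetric] by blast
      qed
      have Vm: "V n \<in> lmeasurable" for n
        by (rule fmeasurableI2[OF U(2) V(2)]) (simp add: V(1) borel_open)
      have "l1_class (indicator (V n)) \<in> K" for n
      proof -
        have "E ` {..<n} \<subseteq> \<B>"
          using E unfolding \<B>'_def by blast
        then show ?thesis
          unfolding K_def V_def by (intro image_eqI[where x = "E ` {..<n}"]) simp_all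
      qed
      then have "l1_class (indicator (V n)) \<in> closure D" for n
        using K_D closure_subset by (meson subsetD)
      moreover have "(\<lambda>n. l1_class (indicator (V n))) \<longlonglongrightarrow> l1_class (indicator U)"
      proof (rule tendsto_l1_class_dominated[where w = "indicator U" and s = "\<lambda>n. indicator (V n)"])
        show "integrable lebesgue (indicator (V i) :: 'a \<Rightarrow> real)" for i
          using Vm[of i] by (auto simp: fmeasurable_def)
        show "integrable lebesgue (indicator U :: 'a \<Rightarrow> real)"
          using U(2) by (auto simp: fmeasurable_def)
        show "integrable lebesgue (indicator U :: 'a \<Rightarrow> real)"
          using U(2) by (auto simp: fmeasurable_def)
        show "\<bar>indicator (V i) x\<bar> \<le> (indicator U x :: real)" for i x
          using V(2)[of i] by (auto simp: indicator_def)
        show "(\<lambda>i. indicator (V i) x) \<longlonglongrightarrow> (indicator U x :: real)" for x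
        proof (cases "x \<in> U")
          case True
          then obtain k where "x \<in> E k"
            unfolding \<B>'_U E[symmetric] by blast
          then have "indicator (V i) x = (1::real)" if "i \<ge> Suc k" for i
            using that unfolding V_def by (auto simp: indicator_def)
          then have "\<forall>\<^sub>F i in sequentially. indicator (V i) x = (indicator U x :: real)"
            using True by (intro eventually_sequentiallyI[of "Suc k"]) auto
          then show ?thesis by (rule tendsto_eventually)
        next
          case False
          then have "indicator (V i) x = (indicator U x :: real)" for i
            using V(2)[of i] by (auto simp: indicator_def)
          then show ?thesis by simp
        qed
      qed
      ultimately show ?thesis by (rule C_lim[rotated])
    qed
  qed
  have C_meas: "l1_class (indicator A) \<in> closure D" if A: "A \<in> lmeasurable" for A
  proof -
    have "\<exists>y\<in>closure D. dist y (l1_class (indicator A)) < e" if e: "e > 0" for e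
    proof -
      obtain U where "open U" "U \<in> lmeasurable"
        "dist (l1_class (indicator U)) (l1_class (indicator A)) < e"
        using l1_indicator_approx_open[OF A e] by blast
      then show ?thesis
        using C_open[of U] by (intro bexI[of _ "l1_class (indicator U)"])
    qed
    then have "l1_class (indicator A) \<in> closure (closure D)"
      unfolding closure_approachable by blast
    then show ?thesis by simp
  qed
  have C_fun: "l1_class f \<in> closure D" if "integrable lebesgue f" for f
    using that
  proof (induction rule: integrable_induct)
    case (base A c)
    have "integrable lebesgue (indicator A :: 'a \<Rightarrow> real)"
      using base by auto
    then have "l1_class (\<lambda>x. indicator A x *\<^sub>R c) = c *\<^sub>R l1_class (indicator A)"
      by (simp add: l1_class_scaleR mult.commute)
    then show ?case
      using C_scale[OF C_meas[of A]] base by (simp add: fmeasurable_def)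
  next
    case (add f g)
    then show ?case
      using C_add by (simp add: l1_class_add[symmetric])
  next
    case (lim f s)
    have "(\<lambda>i. l1_class (s i)) \<longlonglongrightarrow> l1_class f"
      using lim by (intro tendsto_l1_class_dominated[where w = "\<lambda>x. 2 * \<bar>f x\<bar>"]) auto
    then show ?case
      using lim C_lim by blast
  qed
  have "f \<in> closure D" for f
    using C_fun[OF l1_fun_integrable[of f]] by (simp add: l1_class_l1_fun)
  then show ?thesis
    using \<open>countable D\<close> by blast
qed

instance l1 :: (euclidean_space) second_countable_topology
proof
  obtain D :: "'a l1 set" where D: "countable D" "closure D = UNIV"
    using countable_dense_l1 by blast
  define B where "B = (\<lambda>(d, n). ball d (1 / real (Suc n))) ` (D \<times> (UNIV :: nat set))"
  have "countable B"
    unfolding B_def using D(1) by auto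
  moreover have "topological_basis B"
  proof (rule topological_basisI)
    show "open b" if "b \<in> B" for b
      using that unfolding B_def by auto
    fix U and x :: "'a l1"
    assume "open U" "x \<in> U"
    then obtain e where e: "e > 0" "ball x e \<subseteq> U"
      by (auto simp: open_contains_ball)
    then obtain n where n: "inverse (real (Suc n)) < e / 2"
      using reals_Archimedean[of "e/2"] by auto
    have "x \<in> closure D" using D(2) by simp
    then obtain d where d: "d \<in> D" "dist d x < 1 / real (Suc n)"
      unfolding closure_approachable by (metis of_nat_0_less_iff zero_less_Suc zero_less_divide_1_iff)
    have "ball d (1 / real (Suc n)) \<subseteq> ball x e"
    proof
      fix y assume "y \<in> ball d (1 / real (Suc n))"
      then have "dist x y < 1 / real (Suc n) + 1 / real (Suc n)"
        using d(2) dist_triangle[of x y d] by (simp add: dist_commute)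
      then show "y \<in> ball x e"
        using n by (simp add: inverse_eq_divide)
    qed
    moreover have "x \<in> ball d (1 / real (Suc n))"
      using d(2) by simp
    moreover have "ball d (1 / real (Suc n)) \<in> B"
      unfolding B_def using d(1) by (intro image_eqI[where x = "(d, n)"]) auto
    ultimately show "\<exists>B'\<in>B. x \<in> B' \<and> B' \<subseteq> U"
      using e(2) by blast
  qed
  ultimately show "\<exists>B :: 'a l1 set set. countable B \<and> open = generate_topology B"
    using topological_basis_imp_subbasis by blast
qed


text \<open>
  \<open>L\<^sup>1(G)\<close> is realised as the subspace of \<open>L\<^sup>1(\<real>\<^sup>N)\<close> of the classes vanishing almost everywhere
  outside \<open>G\<close>, which is isometric to the space of classes of integrable functions on \<open>G\<close> via
  extension by zero. The function \<^const>\<open>l1_fun\<close> picks some representative of a class, so its values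
  are meaningful only up to null sets.
\<close>

definition l1_on :: "'a::euclidean_space set \<Rightarrow> 'a l1 set" where
  "l1_on G = {f. AE x in lebesgue. x \<notin> G \<longrightarrow> l1_fun f x = 0}"

lift_definition l1_pos :: "'a::euclidean_space l1 \<Rightarrow> 'a l1" is "\<lambda>f x. max (f x) 0"
  by (auto simp: l1_rel_def)

lift_definition l1_neg :: "'a::euclidean_space l1 \<Rightarrow> 'a l1" is "\<lambda>f x. max (- f x) 0"
  by (auto simp: l1_rel_def)

lemma l1_class_in_l1_on:
  assumes "integrable lebesgue f"
  shows "l1_class f \<in> l1_on G \<longleftrightarrow> (AE x in lebesgue. x \<notin> G \<longrightarrow> f x = 0)"
  unfolding l1_on_def mem_Collect_eq
  by (rule eventually_cong[OF l1_fun_l1_class[OF assms]]) simp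

lemma l1_on_norm:
  assumes "f \<in> l1_on G" "G \<in> sets lebesgue"
  shows "norm f = (\<integral>x. \<bar>l1_fun f x\<bar> \<partial>lebesgue_on G)"
proof -
  have [measurable]: "l1_fun f \<in> borel_measurable lebesgue"
    using l1_fun_integrable by auto
  have "norm f = (\<integral>x. \<bar>l1_fun f x\<bar> \<partial>lebesgue)"
    using norm_l1_class[OF l1_fun_integrable[of f]] by (simp add: l1_class_l1_fun)
  also have "\<dots> = (\<integral>x. indicator G x *\<^sub>R \<bar>l1_fun f x\<bar> \<partial>lebesgue)"
    using assms by (intro integral_cong_AE) (auto simp: l1_on_def indicator_def elim: eventually_mono)
  also have "\<dots> = (\<integral>x. \<bar>l1_fun f x\<bar> \<partial>lebesgue_on G)"
    using assms(2) by (subst integral_restrict_space) auto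
  finally show ?thesis .
qed

lemma l1_on_extension:
  fixes f :: "'a::euclidean_space \<Rightarrow> real"
  assumes "integrable (lebesgue_on G) f" "G \<in> sets lebesgue"
  shows "l1_class (\<lambda>x. indicator G x *\<^sub>R f x) \<in> l1_on G"
    and "AE x in lebesgue_on G. l1_fun (l1_class (\<lambda>x. indicator G x *\<^sub>R f x)) x = f x"
proof -
  have i: "integrable lebesgue (\<lambda>x. indicator G x *\<^sub>R f x)"
    using assms by (subst integrable_restrict_space[symmetric]) auto
  show "l1_class (\<lambda>x. indicator G x *\<^sub>R f x) \<in> l1_on G"
    by (subst l1_class_in_l1_on[OF i]) auto
  show "AE x in lebesgue_on G. l1_fun (l1_class (\<lambda>x. indicator G x *\<^sub>R f x)) x = f x"
    using l1_fun_l1_class[OF i] assms(2)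
    by (subst AE_restrict_space_iff) (auto elim: eventually_mono)
qed

lemma subspace_l1_on: "subspace (l1_on G)"
proof (rule subspaceI)
  show "0 \<in> l1_on G"
    unfolding zero_l1.abs_eq by (subst l1_class_in_l1_on) (auto simp: zero_l1_def)
  fix f g :: "'a l1" and c :: real
  assume f: "f \<in> l1_on G"
  show "c *\<^sub>R f \<in> l1_on G"
    using f l1_fun_scaleR[of c f] unfolding l1_on_def mem_Collect_eq
    by eventually_elim simp
  assume g: "g \<in> l1_on G"
  show "f + g \<in> l1_on G"
    using f g l1_fun_add[of f g] unfolding l1_on_def mem_Collect_eq
    by eventually_elim simp
qed

lemma closed_l1_on:
  fixes G :: "'a::euclidean_space set"
  assumes "G \<in> sets lebesgue"
  shows "closed (l1_on G)"
  unfolding closed_sequential_limits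
proof (intro allI impI, elim conjE)
  fix s :: "nat \<Rightarrow> 'a l1" and f
  assume s: "\<forall>n. s n \<in> l1_on G" and lim: "s \<longlonglongrightarrow> f"
  have i: "integrable lebesgue (\<lambda>x. indicator (- G) x * l1_fun f x)"
    using integrable_mult_indicator[OF _ l1_fun_integrable, of "- G" f] assms by (simp add: Compl_in_sets_lebesgue)
  have le: "(\<integral>x. \<bar>indicator (- G) x * l1_fun f x\<bar> \<partial>lebesgue) \<le> dist (s n) f" for n
  proof -
    have "(\<integral>x. \<bar>indicator (- G) x * l1_fun f x\<bar> \<partial>lebesgue)
        \<le> (\<integral>x. \<bar>l1_fun (s n) x - l1_fun f x\<bar> \<partial>lebesgue)"
    proof (rule integral_mono_AE)
      show "AE x in lebesgue. \<bar>indicator (- G) x * l1_fun f x\<bar> \<le> \<bar>l1_fun (s n) x - l1_fun f x\<bar>"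
        using s[unfolded l1_on_def, THEN spec, of n] by (auto simp: indicator_def elim: eventually_mono)
      show "integrable lebesgue (\<lambda>x. \<bar>indicator (- G) x * l1_fun f x\<bar>)"
        by (rule integrable_abs) (rule i)
      show "integrable lebesgue (\<lambda>x. \<bar>l1_fun (s n) x - l1_fun f x\<bar>)"
        by (intro integrable_abs Bochner_Integration.integrable_diff l1_fun_integrable)
    qed
    also have "\<dots> = dist (s n) f"
      using dist_l1_class[OF l1_fun_integrable[of "s n"] l1_fun_integrable[of f]]
      by (simp add: l1_class_l1_fun)
    finally show ?thesis .
  qed
  have "(\<lambda>n. dist (s n) f) \<longlonglongrightarrow> 0"
    using lim by (rule tendsto_dist_iff[THEN iffD1])
  then have "(\<integral>x. \<bar>indicator (- G) x * l1_fun f x\<bar> \<partial>lebesgue) \<le> 0"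
    by (rule LIMSEQ_le_const) (use le in auto)
  moreover have "0 \<le> (\<integral>x. \<bar>indicator (- G) x * l1_fun f x\<bar> \<partial>lebesgue)"
    by (rule Bochner_Integration.integral_nonneg) simp
  ultimately have "(\<integral>x. \<bar>indicator (- G) x * l1_fun f x\<bar> \<partial>lebesgue) = 0"
    by linarith
  then have "AE x in lebesgue. \<bar>indicator (- G) x * l1_fun f x\<bar> = 0"
    by (subst (asm) integral_nonneg_eq_0_iff_AE) (use i in auto)
  then show "f \<in> l1_on G"
    unfolding l1_on_def mem_Collect_eq by (rule eventually_mono) (auto simp: indicator_def)
qed

definition measurable_convex_integrand :: "'a::euclidean_space set \<Rightarrow> ('a \<Rightarrow> real \<Rightarrow> ereal) \<Rightarrow> bool" where
  "measurable_convex_integrand G \<phi> \<longleftrightarrow>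
    (\<forall>x\<in>G.
      (\<forall>v. \<phi> x v \<noteq> -\<infinity>) \<and> (\<exists>v. \<phi> x v \<noteq> \<infinity>) \<and>
      (\<forall>v. \<phi> x v \<le> Liminf (at v) (\<phi> x)) \<and>
      (\<forall>v w. \<forall>r\<in>{0..1}. \<phi> x ((1 - r) * v + r * w) \<le> ereal (1 - r) * \<phi> x v + ereal r * \<phi> x w)) \<and>
    (\<forall>v. (\<lambda>x. \<phi> x v) \<in> borel_measurable (lebesgue_on G))"

text \<open>
  For proper \<open>\<phi>\<close> this is empty wherever \<open>\<phi> v = \<infinity>\<close>: choosing \<open>w\<close> with \<open>\<phi> w < \<infinity>\<close>, the right-hand
  side is \<open>-\<infinity>\<close>.
\<close>

definition subgradients :: "(real \<Rightarrow> ereal) \<Rightarrow> real \<Rightarrow> real set" where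
  "subgradients \<phi> v = {p. \<forall>w. ereal (p * (w - v)) \<le> \<phi> w - \<phi> v}"

text \<open>
  The supremum is taken in \<^typ>\<open>real\<close>: if \<open>\<phi>\<close> is a finite convex function, then the set below is
  nonempty and bounded.
\<close>

definition subgradient_bound :: "(real \<Rightarrow> ereal) \<Rightarrow> real \<Rightarrow> real" where
  "subgradient_bound \<phi> C = Sup {\<bar>p\<bar> | p v. p \<in> subgradients \<phi> v \<and> \<bar>v\<bar> \<le> C}"

definition square_integrable_on :: "'a::euclidean_space set \<Rightarrow> ('a \<Rightarrow> real) \<Rightarrow> bool" where
  "square_integrable_on G f \<longleftrightarrow>
    f \<in> borel_measurable (lebesgue_on G) \<and> integrable (lebesgue_on G) (\<lambda>x. (f x)\<^sup>2)"

definition linear_operator_in :: "'b::real_vector set \<Rightarrow> 'b set \<Rightarrow> ('b \<Rightarrow> 'b) \<Rightarrow> bool" where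
  "linear_operator_in X D A \<longleftrightarrow>
    subspace D \<and> D \<subseteq> X \<and> A ` D \<subseteq> X \<and>
    (\<forall>v\<in>D. \<forall>w\<in>D. A (v + w) = A v + A w) \<and> (\<forall>c. \<forall>v\<in>D. A (c *\<^sub>R v) = c *\<^sub>R A v)"

definition resolvent :: "'b::real_vector set \<Rightarrow> ('b \<Rightarrow> 'b) \<Rightarrow> real \<Rightarrow> 'b \<Rightarrow> 'b" where
  "resolvent D A \<mu> = inv_into D (\<lambda>v. v + \<mu> *\<^sub>R A v)"

definition ess_sup_on :: "'a::euclidean_space set \<Rightarrow> 'a l1 \<Rightarrow> ereal" where
  "ess_sup_on G f = esssup (lebesgue_on G) (\<lambda>x. ereal (l1_fun f x))"

definition composite_relation ::
  "'a::euclidean_space set \<Rightarrow> ('a \<Rightarrow> real \<Rightarrow> real set) \<Rightarrow> 'a l1 set \<Rightarrow> ('a l1 \<Rightarrow> 'a l1) \<Rightarrow> 'a l1 \<Rightarrow> 'a l1 set"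
where
  "composite_relation G \<beta> D A u = {f. u \<in> l1_on G \<and> f \<in> l1_on G \<and>
    (\<exists>v\<in>D. A v = f \<and> (AE x in lebesgue_on G. l1_fun u x \<in> \<beta> x (l1_fun v x)))}"

text \<open>
  The discretization is \<open>0 = t 0 < \<dots> < t n = T\<close> with data \<open>F' 1, \<dots>, F' n\<close>. The values \<open>s\<^sub>j\<close> of the
  step function are \<open>s (t j)\<close>.
\<close>

definition eps_solution ::
  "'b::{banach, second_countable_topology} set \<Rightarrow> ('b \<Rightarrow> 'b set) \<Rightarrow> (real \<Rightarrow> 'b) \<Rightarrow> real \<Rightarrow> real \<Rightarrow>
    nat \<Rightarrow> (nat \<Rightarrow> real) \<Rightarrow> (nat \<Rightarrow> 'b) \<Rightarrow> (real \<Rightarrow> 'b) \<Rightarrow> bool"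
where
  "eps_solution X \<A> F T \<epsilon> n t F' s \<longleftrightarrow>
    t 0 = 0 \<and> t n = T \<and> (\<forall>j\<in>{1..n}. t (j - 1) < t j) \<and>
    (\<forall>j\<in>{1..n}. F' j \<in> X) \<and>
    (\<forall>j\<in>{0..n}. s (t j) \<in> X) \<and>
    (\<forall>j\<in>{1..n}. \<forall>r\<in>{t (j - 1)<..t j}. s r = s (t j)) \<and>
    (\<forall>j\<in>{1..n}. t j - t (j - 1) \<le> \<epsilon>) \<and>
    (\<Sum>j=1..n. \<integral>r. norm (F r - F' j) \<partial>lebesgue_on {t (j - 1)<..<t j}) < \<epsilon> \<and>
    (\<forall>j\<in>{1..n}. \<exists>w\<in>\<A> (s (t j)).
      (s (t j) - s (t (j - 1))) /\<^sub>R (t j - t (j - 1)) + w = F' j)"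

definition C0_solution ::
  "'b::{banach, second_countable_topology} set \<Rightarrow> ('b \<Rightarrow> 'b set) \<Rightarrow> (real \<Rightarrow> 'b) \<Rightarrow> real \<Rightarrow> 'b \<Rightarrow> (real \<Rightarrow> 'b) \<Rightarrow> bool"
where
  "C0_solution X \<A> F T u\<^sub>0 u \<longleftrightarrow>
    continuous_on {0..T} u \<and> u ` {0..T} \<subseteq> X \<and> u 0 = u\<^sub>0 \<and>
    (\<forall>\<epsilon>>0. \<exists>n t F' s. eps_solution X \<A> F T \<epsilon> n t F' s \<and> (\<forall>r\<in>{0..T}. norm (u r - s r) \<le> \<epsilon>))"

definition bochner_L1 :: "'b::{banach, second_countable_topology} set \<Rightarrow> real \<Rightarrow> (real \<Rightarrow> 'b) \<Rightarrow> bool" where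
  "bochner_L1 X T F \<longleftrightarrow> (\<forall>t\<in>{0<..<T}. F t \<in> X) \<and> integrable (lebesgue_on {0<..<T}) F"

end

theory Submission
  imports Defs
begin

text \<open>
  Write \<open>p f\<close> for the norm of the positive part of \<open>f\<close>. For \<open>f\<^sub>i = A \<chi>\<^sub>i\<close> in \<open>\<A> u\<^sub>i\<close> put \<open>u = u\<^sub>1 - u\<^sub>2\<close> and
  \<open>\<chi> = \<chi>\<^sub>1 - \<chi>\<^sub>2\<close>. Since \<open>u\<close> and \<open>\<chi>\<close> have compatible signs, some \<open>g\<close> is a section of both \<open>sign\<^sup>+ \<chi>\<close> and
  \<open>sign\<^sup>+ u\<close>, and \<open>\<integral> g * A \<chi> \<ge> 0\<close> because the resolvents of \<open>A\<close> are positive contractions. Hence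
  \<open>p u \<le> p (u + \<lambda> (f\<^sub>1 - f\<^sub>2))\<close>.

  For two \<open>\<epsilon>\<close>-solutions with values \<open>x\<^sub>i\<close>, \<open>y\<^sub>j\<close> on different grids \<open>t\<^sub>i\<close>, \<open>t'\<^sub>j\<close> this yields a recursive inequality
  for \<open>p (x\<^sub>i - y\<^sub>j)\<close> in the two indices, a discrete form of \<open>(\<partial>\<^sub>s + \<partial>\<^sub>t) a \<le> h\<close>. It is compared with a
  supersolution that contains the quadratic penalty \<open>(t\<^sub>i - t'\<^sub>j)\<^sup>2\<close>; to bound the source term near the
  diagonal, one of the right-hand sides is approximated in \<open>L\<^sup>1\<close> by a continuous function. The estimate for
  negative parts follows by exchanging the two solutions, that for the norms by addition.
\<close>

subsection \<open>Accretivity with respect to a sublinear functional\<close>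

text \<open>The argument on two grids rests on these properties of the functional. Symmetry is not
  among them, so that the norm of the positive part qualifies as well as the norm.\<close>

locale sublinear_functional =
  fixes p :: "'b::{banach, second_countable_topology} \<Rightarrow> real"
  assumes add_le: "p (x + y) \<le> p x + p y"
    and scale: "0 \<le> c \<Longrightarrow> p (c *\<^sub>R x) = c * p x"
    and nonneg: "0 \<le> p x"
    and le_norm: "p x \<le> norm x"
begin

lemma le_add_norm: "p x \<le> p y + norm (x - y)"
  using add_le[of y "x - y"] le_norm[of "x - y"] by simp

lemma abs_diff_le: "\<bar>p x - p y\<bar> \<le> norm (x - y)"
  using le_add_norm[of x y] le_add_norm[of y x] by (simp add: abs_le_iff norm_minus_commute)

lemma continuous_on_UNIV: "continuous_on UNIV p"
proof (rule continuous_on_iff[THEN iffD2], intro ballI allI impI)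
  fix x :: 'b and e :: real assume "0 < e"
  then show "\<exists>d>0. \<forall>x'\<in>UNIV. dist x' x < d \<longrightarrow> dist (p x') (p x) < e"
    by (intro exI[of _ e]) (auto simp: dist_norm intro: le_less_trans[OF abs_diff_le])
qed

lemma borel_measurable [measurable]: "p \<in> borel_measurable borel"
  by (rule borel_measurable_continuous_onI) (rule continuous_on_UNIV)

text \<open>For \<open>p\<close> the norm this is the usual accretivity. For \<open>p\<close> the
  norm of the positive part it is T-accretivity, the one-sided form, which makes the resolvents of
  \<open>\<A>\<close> order preserving.\<close>

definition accretive :: "('b \<Rightarrow> 'b set) \<Rightarrow> bool" where
  "accretive \<A> \<longleftrightarrow> (\<forall>x y f g c. f \<in> \<A> x \<longrightarrow> g \<in> \<A> y \<longrightarrow> 0 < c \<longrightarrow>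
    p (x - y) \<le> p (x - y + c *\<^sub>R (f - g)))"

text \<open>For c = dd'/(d+d') the implicit Euler equations turn
  \<open>x - y + c *\<^sub>R (f - g)\<close> into the convex combination of \<open>x0 - y\<close>
  and \<open>x - y0\<close> with weights d'/(d+d') and d/(d+d'), plus
  \<open>c *\<^sub>R (F - F')\<close>. Accretivity for this c and sublinearity give the
  bound.\<close>

lemma accretive_implicit_steps:
  assumes "accretive \<A>" and d: "0 < d" "0 < d'"
    and f: "f \<in> \<A> x" "(x - x0) /\<^sub>R d + f = F"
    and g: "g \<in> \<A> y" "(y - y0) /\<^sub>R d' + g = F'"
  shows "(d + d') * p (x - y) \<le> d' * p (x0 - y) + d * p (x - y0) + d * d' * p (F - F')"
proof -
  define c where "c = d * d' / (d + d')"
  have "c > 0" using d by (simp add: c_def)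
  have dd: "d + d' > 0" using d by simp
  have fe: "f = F - (x - x0) /\<^sub>R d" and ge: "g = F' - (y - y0) /\<^sub>R d'"
    using f g by auto
  have 2: "(d * d') *\<^sub>R (f - g) = (d * d') *\<^sub>R (F - F') - d' *\<^sub>R (x - x0) + d *\<^sub>R (y - y0)"
  proof -
    have *: "(d * d') *\<^sub>R ((x - x0) /\<^sub>R d) = d' *\<^sub>R (x - x0)"
      "(d * d') *\<^sub>R ((y - y0) /\<^sub>R d') = d *\<^sub>R (y - y0)"
      using d by (auto simp: mult_ac)
    have "f - g = (F - F') - (x - x0) /\<^sub>R d + (y - y0) /\<^sub>R d'"
      by (simp add: fe ge)
    then show ?thesis
      by (simp only: scaleR_add_right scaleR_diff_right[of _ "F - F'"] scaleR_diff_right[of _ "F - F' - _"] *)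
  qed
  have 1: "(d + d') *\<^sub>R (x - y + c *\<^sub>R (f - g))
      = d' *\<^sub>R (x0 - y) + (d *\<^sub>R (x - y0) + (d * d') *\<^sub>R (F - F'))"
  proof -
    have "(d + d') *\<^sub>R (x - y + c *\<^sub>R (f - g)) = (d + d') *\<^sub>R (x - y) + ((d + d') * c) *\<^sub>R (f - g)"
      by (simp add: scaleR_add_right)
    also have "(d + d') * c = d * d'" using dd by (simp add: c_def)
    also have "(d * d') *\<^sub>R (f - g) = (d * d') *\<^sub>R (F - F') - d' *\<^sub>R (x - x0) + d *\<^sub>R (y - y0)"
      by (rule 2)
    finally show ?thesis
      by (simp add: scaleR_diff_right scaleR_add_left)
  qed
  have "(d + d') * p (x - y) \<le> (d + d') * p (x - y + c *\<^sub>R (f - g))"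
    using assms \<open>c > 0\<close> dd unfolding accretive_def by (intro mult_left_mono) auto
  also have "\<dots> = p (d' *\<^sub>R (x0 - y) + (d *\<^sub>R (x - y0) + (d * d') *\<^sub>R (F - F')))"
    using dd by (simp add: scale[symmetric] 1)
  also have "\<dots> \<le> p (d' *\<^sub>R (x0 - y)) + (p (d *\<^sub>R (x - y0)) + p ((d * d') *\<^sub>R (F - F')))"
    by (rule order_trans[OF add_le add_left_mono[OF add_le]])
  finally show ?thesis
    using d by (simp add: scale)
qed

end

section \<open>Comparison principle for a recursion in two indices\<close>

text \<open>Induction on \<open>i + j\<close> against the right-hand side as supersolution: its sums
  reproduce the sources \<open>\<gamma>\<close> and \<open>e\<close>, its linear term pays for
  \<open>\<kappa>\<close> and for the discretization error of the penalty. The penalty reaches the a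
  priori bound \<open>C\<close> at distance \<open>w\<close> from the diagonal, so the sources and
  the boundary values are to be controlled only closer to it.\<close>

lemma discrete_comparison:
  fixes a h :: "nat \<Rightarrow> nat \<Rightarrow> real" and t t' \<gamma> e :: "nat \<Rightarrow> real"
  assumes t: "\<And>i. i \<in> {1..m} \<Longrightarrow> t (i - 1) < t i \<and> t i - t (i - 1) \<le> \<epsilon>"
    and t': "\<And>j. j \<in> {1..n} \<Longrightarrow> t' (j - 1) < t' j \<and> t' j - t' (j - 1) \<le> \<epsilon>"
    and rec: "\<And>i j. i \<in> {1..m} \<Longrightarrow> j \<in> {1..n} \<Longrightarrow>
      ((t i - t (i - 1)) + (t' j - t' (j - 1))) * a i j
      \<le> (t' j - t' (j - 1)) * a (i - 1) j + (t i - t (i - 1)) * a i (j - 1)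
        + (t i - t (i - 1)) * (t' j - t' (j - 1)) * h i j"
    and C: "\<And>i j. i \<le> m \<Longrightarrow> j \<le> n \<Longrightarrow> a i j \<le> C" "0 \<le> C"
    and w: "0 < w"
    and h: "\<And>i j. i \<in> {1..m} \<Longrightarrow> j \<in> {1..n} \<Longrightarrow> \<bar>t i - t' j\<bar> < w \<Longrightarrow> h i j \<le> \<gamma> i + e j + \<kappa>"
    and \<gamma>: "\<And>i. 0 \<le> \<gamma> i" and e: "\<And>j. 0 \<le> e j" and B: "0 \<le> B"
    and left: "\<And>j. j \<le> n \<Longrightarrow> \<bar>t 0 - t' j\<bar> < w \<Longrightarrow> a 0 j \<le> B"
    and bottom: "\<And>i. i \<le> m \<Longrightarrow> \<bar>t i - t' 0\<bar> < w \<Longrightarrow> a i 0 \<le> B"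
    and \<kappa>': "\<kappa> + 2 * \<epsilon> * (C / w\<^sup>2) \<le> \<kappa>'" "0 \<le> \<kappa>'"
    and ij: "i \<le> m" "j \<le> n"
  shows "a i j \<le> B + (\<Sum>k=1..i. (t k - t (k - 1)) * \<gamma> k) + (\<Sum>l=1..j. (t' l - t' (l - 1)) * e l)
    + \<kappa>' * (t i - t 0) + C / w\<^sup>2 * (t i - t' j)\<^sup>2"
proof -
  define q where "q = C / w\<^sup>2"
  define S where "S i = (\<Sum>k=1..i. (t k - t (k - 1)) * \<gamma> k)" for i
  define S' where "S' j = (\<Sum>l=1..j. (t' l - t' (l - 1)) * e l)" for j
  define \<Psi> where "\<Psi> i j = B + S i + S' j + \<kappa>' * (t i - t 0) + q * (t i - t' j)\<^sup>2" for i j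
  have q: "0 \<le> q" using C w by (simp add: q_def)
  have t_mono: "t 0 \<le> t i" if "i \<le> m" for i
    using that
  proof (induction i)
    case (Suc i) then show ?case using t[of "Suc i"] by auto
  qed simp
  have S: "0 \<le> S i" if "i \<le> m" for i
    unfolding S_def using that t \<gamma> by (intro sum_nonneg mult_nonneg_nonneg) (auto simp: less_imp_le)
  have S': "0 \<le> S' j" if "j \<le> n" for j
    unfolding S'_def using that t' e by (intro sum_nonneg mult_nonneg_nonneg) (auto simp: less_imp_le)
  have "a i j \<le> \<Psi> i j"
    using ij
  proof (induction "i + j" arbitrary: i j rule: less_induct)
    case less
    have base: "B + q * (t i - t' j)\<^sup>2 \<le> \<Psi> i j"
      using S[of i] S'[of j] t_mono[of i] less.prems \<kappa>' by (simp add: \<Psi>_def)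
    show ?case
    proof (cases "\<bar>t i - t' j\<bar> < w")
      \<comment> \<open>Far from the diagonal the quadratic penalty alone exceeds \<open>C\<close>.\<close>
      case False
      have "w\<^sup>2 \<le> (t i - t' j)\<^sup>2"
        using False w by (intro abs_le_square_iff[THEN iffD1]) auto
      then have "C \<le> q * (t i - t' j)\<^sup>2"
        using mult_left_mono[of "w\<^sup>2" "(t i - t' j)\<^sup>2" q] q w by (simp add: q_def)
      then show ?thesis
        using base B C(1)[of i j] less.prems by linarith
    next
      case near: True
      have q': "0 \<le> q * (t i - t' j)\<^sup>2" using q by simp
      consider "i = 0" | "j = 0" | "i \<in> {1..m}" "j \<in> {1..n}"
        using less.prems by force
      then show ?thesis
      proof cases
        case 1 then show ?thesis using left[of j] near less.prems base q' by simp
      next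
        case 2 then show ?thesis using bottom[of i] near less.prems base q' by simp
      next
        case 3
        define d d' where "d = t i - t (i - 1)" and "d' = t' j - t' (j - 1)"
        have d: "0 < d" "d \<le> \<epsilon>" "0 < d'" "d' \<le> \<epsilon>" using t[of i] t'[of j] 3 by (auto simp: d_def d'_def)
        have IH: "a (i - 1) j \<le> \<Psi> (i - 1) j" "a i (j - 1) \<le> \<Psi> i (j - 1)"
          using 3 less.prems by (auto intro!: less.hyps)
        have Si: "S i = S (i - 1) + d * \<gamma> i" using 3 unfolding S_def d_def by (cases i) auto
        have Sj: "S' j = S' (j - 1) + d' * e j" using 3 unfolding S'_def d'_def by (cases j) auto
        have ti: "t (i - 1) = t i - d" and tj: "t' (j - 1) = t' j - d'" by (auto simp: d_def d'_def)
        \<comment> \<open>In the weighted sum of the two backward differences the terms linear in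
          \<open>t i - t' j\<close> cancel. The second order terms leave the defect
          \<open>q * (d + d')\<close>, at most \<open>2 * \<epsilon> * q\<close>, which
          \<open>\<kappa>' - \<kappa>\<close> covers.\<close>
        have i1: "\<Psi> (i - 1) j = \<Psi> i j - d * \<gamma> i - \<kappa>' * d - q * (2 * (t i - t' j) * d - d\<^sup>2)"
          unfolding \<Psi>_def Si ti by (simp add: algebra_simps power2_eq_square)
        have j1: "\<Psi> i (j - 1) = \<Psi> i j - d' * e j - q * (- 2 * (t i - t' j) * d' - d'\<^sup>2)"
          unfolding \<Psi>_def Sj tj by (simp add: algebra_simps power2_eq_square)
        have "q * (d + d') \<le> 2 * \<epsilon> * q"
          using mult_left_mono[of "d + d'" "2 * \<epsilon>" q] q d by (simp add: mult_ac)
        then have hh: "h i j \<le> \<gamma> i + e j + \<kappa>' - q * (d + d')"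
          using h[of i j] near 3 \<kappa>' by (simp add: q_def)
        have "(d + d') * a i j \<le> d' * a (i - 1) j + d * a i (j - 1) + d * d' * h i j"
          using rec[of i j] 3 by (simp add: d_def d'_def)
        also have "\<dots> \<le> d' * \<Psi> (i - 1) j + d * \<Psi> i (j - 1)
            + d * d' * (\<gamma> i + e j + \<kappa>' - q * (d + d'))"
          using IH hh d by (intro add_mono mult_left_mono) auto
        also have "\<dots> = (d + d') * \<Psi> i j"
          unfolding i1 j1 by (simp add: algebra_simps power2_eq_square)
        finally show ?thesis using d by (simp add: mult_le_cancel_left)
      qed
    qed
  qed
  then show ?thesis by (simp add: \<Psi>_def S_def S'_def q_def)
qed

subsection \<open>Integrals over partitions and approximation by continuous functions\<close>

lemma integrable_lebesgue_on_subset: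
  fixes f :: "'a::euclidean_space \<Rightarrow> 'b::{banach, second_countable_topology}"
  assumes "integrable (lebesgue_on S) f" "S' \<subseteq> S" "S \<in> sets lebesgue" "S' \<in> sets lebesgue"
  shows "integrable (lebesgue_on S') f"
proof -
  have "set_integrable lebesgue S f"
    using assms by (simp add: set_integrable_def integrable_restrict_space)
  then have "set_integrable lebesgue S' f"
    using assms by (intro set_integrable_subset[of lebesgue S f S'])
  then show ?thesis
    using assms by (simp add: set_integrable_def integrable_restrict_space)
qed

text \<open>Induction over multiples of indicators, sums and dominated limits. An indicator is an
  almost everywhere limit of continuous functions, and the finite measure of \<open>S\<close> makes
  constants integrable majorants. Later this replaces a right-hand side by one with a modulus of
  continuity.\<close>

lemma integrable_lebesgue_on_continuous_approx:
  fixes f :: "'a::euclidean_space \<Rightarrow> 'b::{banach, second_countable_topology}"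
  assumes "integrable (lebesgue_on S) f" and S: "S \<in> lmeasurable" and "0 < e"
  obtains g where "continuous_on UNIV g" "integrable (lebesgue_on S) g"
    "(\<integral>x. norm (f x - g x) \<partial>lebesgue_on S) < e"
proof -
  let ?M = "lebesgue_on S"
  have "\<forall>e>0. \<exists>g. continuous_on UNIV g \<and> integrable ?M g \<and> (\<integral>x. norm (f x - g x) \<partial>?M) < e"
    using assms(1)
  proof (induction rule: integrable_induct)
    case (base A c)
    then have A: "A \<in> sets lebesgue"
      using S by (auto simp: sets_restrict_space_iff)
    obtain N g where N: "negligible N" and g: "\<And>n. continuous_on UNIV (g n)"
      and lim: "\<And>x. x \<notin> N \<Longrightarrow> (\<lambda>n. g n x) \<longlonglongrightarrow> indicat_real A x"
      using indicator_measurable_on[OF A] unfolding measurable_on_def by auto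
    \<comment> \<open>Clipping to [0,1] keeps continuity and the limit and supplies the majorant for
      dominated convergence.\<close>
    define k where "k n x = max 0 (min 1 (g n x))" for n x
    have k: "continuous_on UNIV (k n)" "\<bar>k n x\<bar> \<le> 1" for n x
      unfolding k_def using g by (auto intro!: continuous_intros)
    have [measurable]: "k n \<in> borel_measurable ?M" for n
      using k(1) S by (intro continuous_imp_measurable_on_sets_lebesgue continuous_on_subset[OF k(1)]) auto
    have [measurable]: "A \<in> sets ?M" by (rule base(1))
    have fin: "integrable ?M (\<lambda>x. C::real)" for C
      using finite_measure.integrable_const[OF finite_measure_lebesgue_on[OF S]] .
    have "AE x in lebesgue. x \<notin> N"
      using N by (simp add: negligible_iff_null_sets AE_not_in)
    then have ae: "AE x in ?M. x \<notin> N"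
      using S by (subst AE_restrict_space_iff) (auto elim: eventually_mono)
    have "(\<lambda>n. \<integral>x. norm (indicator A x *\<^sub>R c - k n x *\<^sub>R c) \<partial>?M) \<longlonglongrightarrow> (\<integral>x. 0 \<partial>?M)"
    proof (rule integral_dominated_convergence[where w = "\<lambda>_. 2 * norm c"])
      show "AE x in ?M. (\<lambda>n. norm (indicator A x *\<^sub>R c - k n x *\<^sub>R c)) \<longlonglongrightarrow> 0"
        using ae
      proof eventually_elim
        case (elim x)
        have "(\<lambda>n. k n x) \<longlonglongrightarrow> max 0 (min 1 (indicat_real A x))"
          unfolding k_def by (intro tendsto_intros lim elim)
        then have "(\<lambda>n. k n x) \<longlonglongrightarrow> indicat_real A x"
          by (simp add: indicator_def split: if_splits)
        then have "(\<lambda>n. norm (indicator A x *\<^sub>R c - k n x *\<^sub>R c)) \<longlonglongrightarrow> norm (indicator A x *\<^sub>R c - indicator A x *\<^sub>R c)"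
          by (intro tendsto_intros)
        then show ?case by simp
      qed
      show "AE x in ?M. norm (norm (indicator A x *\<^sub>R c - k n x *\<^sub>R c)) \<le> 2 * norm c" for n
      proof (rule AE_I2)
        fix x
        have "\<bar>indicator A x - k n x\<bar> \<le> 2"
          using k(2)[of n x] by (auto simp: indicator_def)
        then show "norm (norm (indicator A x *\<^sub>R c - k n x *\<^sub>R c)) \<le> 2 * norm c"
          by (simp add: scaleR_diff_left[symmetric] mult_right_mono)
      qed
    qed (use fin in auto)
    then have lim0: "(\<lambda>n. \<integral>x. norm (indicator A x *\<^sub>R c - k n x *\<^sub>R c) \<partial>?M) \<longlonglongrightarrow> 0"
      by simp
    show ?case
    proof (intro allI impI)
      fix e :: real assume "0 < e"
      then obtain n where n: "(\<integral>x. norm (indicator A x *\<^sub>R c - k n x *\<^sub>R c) \<partial>?M) < e"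
        using order_tendstoD(2)[OF lim0, of e] by (auto simp: eventually_sequentially)
      have "integrable ?M (\<lambda>x. k n x *\<^sub>R c)"
        by (rule Bochner_Integration.integrable_bound[OF fin[of "norm c"]])
          (use k(2) in \<open>auto intro!: mult_left_le_one_le\<close>)
      then show "\<exists>g. continuous_on UNIV g \<and> integrable ?M g \<and> (\<integral>x. norm (indicator A x *\<^sub>R c - g x) \<partial>?M) < e"
        using n k(1) by (intro exI[of _ "\<lambda>x. k n x *\<^sub>R c"]) (auto intro!: continuous_intros)
    qed
  next
    case (add f1 f2)
    show ?case
    proof (intro allI impI)
      fix e :: real assume "0 < e"
      then have "0 < e/2" by simp
      obtain g1 where g1: "continuous_on UNIV g1" "integrable ?M g1" "(\<integral>x. norm (f1 x - g1 x) \<partial>?M) < e/2"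
        using add.IH(1)[rule_format, OF \<open>0 < e/2\<close>] by (elim exE conjE)
      obtain g2 where g2: "continuous_on UNIV g2" "integrable ?M g2" "(\<integral>x. norm (f2 x - g2 x) \<partial>?M) < e/2"
        using add.IH(2)[rule_format, OF \<open>0 < e/2\<close>] by (elim exE conjE)
      note g = g1 g2
      have "(\<integral>x. norm (f1 x + f2 x - (g1 x + g2 x)) \<partial>?M)
          \<le> (\<integral>x. norm (f1 x - g1 x) + norm (f2 x - g2 x) \<partial>?M)"
        using add g by (intro integral_mono) (auto simp: norm_diff_triangle_ineq)
      also have "\<dots> = (\<integral>x. norm (f1 x - g1 x) \<partial>?M) + (\<integral>x. norm (f2 x - g2 x) \<partial>?M)"
        using add g by simp
      finally show "\<exists>g. continuous_on UNIV g \<and> integrable ?M g \<and> (\<integral>x. norm (f1 x + f2 x - g x) \<partial>?M) < e"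
        using g add by (intro exI[of _ "\<lambda>x. g1 x + g2 x"]) (auto intro!: continuous_intros)
    qed
  next
    case (lim f s)
    have [measurable]: "f \<in> borel_measurable ?M" "s i \<in> borel_measurable ?M" for i
      using lim by auto
    have "(\<lambda>n. \<integral>x. norm (f x - s n x) \<partial>?M) \<longlonglongrightarrow> (\<integral>x. 0 \<partial>?M)"
    proof (rule integral_dominated_convergence[where w = "\<lambda>x. 3 * norm (f x)"])
      show "AE x in ?M. (\<lambda>n. norm (f x - s n x)) \<longlonglongrightarrow> 0"
      proof (rule AE_I2)
        fix x assume "x \<in> space ?M"
        then have "(\<lambda>n. norm (f x - s n x)) \<longlonglongrightarrow> norm (f x - f x)"
          by (intro tendsto_intros lim)
        then show "(\<lambda>n. norm (f x - s n x)) \<longlonglongrightarrow> 0" by simp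
      qed
      \<comment> \<open>The induction scheme provides
        \<open>norm (s n x) \<le> 2 * norm (f x)\<close>, hence the factor 3.\<close>
      show "AE x in ?M. norm (norm (f x - s n x)) \<le> 3 * norm (f x)" for n
      proof (rule AE_I2)
        fix x assume "x \<in> space ?M"
        then show "norm (norm (f x - s n x)) \<le> 3 * norm (f x)"
          using lim.hyps(3)[OF \<open>x \<in> space ?M\<close>, of n] norm_triangle_ineq4[of "f x" "s n x"] by simp
      qed
    qed (use lim in auto)
    then have lim0: "(\<lambda>n. \<integral>x. norm (f x - s n x) \<partial>?M) \<longlonglongrightarrow> 0"
      by simp
    show ?case
    proof (intro allI impI)
      fix e :: real assume "0 < e"
      then obtain n where n: "(\<integral>x. norm (f x - s n x) \<partial>?M) < e/2"
        using order_tendstoD(2)[OF lim0, of "e/2"] by (auto simp: eventually_sequentially)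
      obtain g where g: "continuous_on UNIV g" "integrable ?M g" "(\<integral>x. norm (s n x - g x) \<partial>?M) < e/2"
        using lim.IH half_gt_zero[OF \<open>0 < e\<close>] by blast
      have "(\<integral>x. norm (f x - g x) \<partial>?M) \<le> (\<integral>x. norm (f x - s n x) + norm (s n x - g x) \<partial>?M)"
        using lim g norm_triangle_sub by (intro integral_mono) (auto intro: norm_diff_triangle_le)
      also have "\<dots> = (\<integral>x. norm (f x - s n x) \<partial>?M) + (\<integral>x. norm (s n x - g x) \<partial>?M)"
        using lim g by simp
      finally show "\<exists>g. continuous_on UNIV g \<and> integrable ?M g \<and> (\<integral>x. norm (f x - g x) \<partial>?M) < e"
        using g n by (intro exI[of _ g]) auto
    qed
  qed
  then show ?thesis using that \<open>0 < e\<close> by blast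
qed

text \<open>The open cells omit only the nodes, a null set. Henstock-Kurzweil integrals do not
  distinguish open from closed intervals, so they can be combined at the inner nodes.\<close>

lemma sum_integral_cells:
  fixes f :: "real \<Rightarrow> real" and t :: "nat \<Rightarrow> real"
  assumes "\<And>k. k \<in> {1..n} \<Longrightarrow> t (k - 1) \<le> t k" "integrable (lebesgue_on {t 0<..<t n}) f"
  shows "(\<Sum>k=1..n. \<integral>r. f r \<partial>lebesgue_on {t (k - 1)<..<t k}) = (\<integral>r. f r \<partial>lebesgue_on {t 0<..<t n})"
  using assms
proof (induction n)
  case (Suc n)
  have le: "t n \<le> t (Suc n)" using Suc.prems(1)[of "Suc n"] by simp
  have "t 0 \<le> t m" if "m \<le> n" for m
    using that
  proof (induction m)
    case (Suc m)
    then show ?case using Suc.prems \<open>\<And>k. k \<in> {1..Suc n} \<Longrightarrow> t (k - 1) \<le> t k\<close>[of "Suc m"] by simp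
  qed simp
  then have le0: "t 0 \<le> t n" by simp
  have sub: "integrable (lebesgue_on {a<..<b}) f" if "t 0 \<le> a" "b \<le> t (Suc n)" for a b
    using that by (intro integrable_lebesgue_on_subset[OF Suc.prems(2)]) auto
  have HK: "(\<integral>r. f r \<partial>lebesgue_on {a<..<b}) = integral {a..b} f" "f integrable_on {a..b}"
    if "t 0 \<le> a" "b \<le> t (Suc n)" for a b
    using lebesgue_integral_eq_integral[OF sub[OF that]] integrable_on_lebesgue_on[OF sub[OF that]]
    by (auto simp: integral_open_interval_real integrable_on_open_interval_real)
  have "(\<Sum>k=1..Suc n. \<integral>r. f r \<partial>lebesgue_on {t (k - 1)<..<t k})
      = (\<integral>r. f r \<partial>lebesgue_on {t 0<..<t n}) + (\<integral>r. f r \<partial>lebesgue_on {t n<..<t (Suc n)})"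
    using Suc.IH Suc.prems sub[of "t 0" "t n"] le by simp
  also have "\<dots> = (\<integral>r. f r \<partial>lebesgue_on {t 0<..<t (Suc n)})"
    using le le0 HK by (simp add: Henstock_Kurzweil_Integration.integral_combine)
  finally show ?case .
qed simp

text \<open>Integrating the pointwise bound over each cell replaces the sampled value
  \<open>c k\<close> by \<open>f\<close>, at the price of the discretization error that an
  \<epsilon>-solution keeps small.\<close>

lemma sum_le_integral_cells:
  fixes F :: "real \<Rightarrow> 'b::{banach, second_countable_topology}" and f :: "real \<Rightarrow> real"
    and t c :: "nat \<Rightarrow> real"
  assumes t: "\<And>k. k \<in> {1..n} \<Longrightarrow> t (k - 1) \<le> t k"
    and int: "integrable (lebesgue_on {t 0<..<t n}) f" "integrable (lebesgue_on {t 0<..<t n}) F"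
    and le: "\<And>k r. k \<in> {1..n} \<Longrightarrow> r \<in> {t (k - 1)<..<t k} \<Longrightarrow> c k \<le> f r + norm (F r - F' k)"
  shows "(\<Sum>k=1..n. (t k - t (k - 1)) * c k)
    \<le> (\<integral>r. f r \<partial>lebesgue_on {t 0<..<t n}) + (\<Sum>k=1..n. \<integral>r. norm (F r - F' k) \<partial>lebesgue_on {t (k - 1)<..<t k})"
proof -
  have cell: "{t (k - 1)<..<t k} \<subseteq> {t 0<..<t n}" if "k \<in> {1..n}" for k
  proof -
    have mono: "t l \<le> t m" if "l \<le> m" "m \<le> n" for l m
      using that
    proof (induction m)
      case (Suc m)
      then show ?case using t[of "Suc m"] by (cases "l = Suc m") auto
    qed simp
    show ?thesis using mono[of 0 "k - 1"] mono[of k n] that by fastforce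
  qed
  have "(t k - t (k - 1)) * c k \<le> (\<integral>r. f r \<partial>lebesgue_on {t (k - 1)<..<t k})
      + (\<integral>r. norm (F r - F' k) \<partial>lebesgue_on {t (k - 1)<..<t k})" if k: "k \<in> {1..n}" for k
  proof -
    let ?M = "lebesgue_on {t (k - 1)<..<t k}"
    have "finite_measure ?M"
      by (rule finite_measure_lebesgue_on) simp
    note fin = finite_measure.integrable_const[OF this]
    have i: "integrable ?M f" "integrable ?M F"
      using int cell[OF k] by (auto intro!: integrable_lebesgue_on_subset[of "{t 0<..<t n}"])
    have n: "integrable ?M (\<lambda>r. norm (F r - F' k))"
      by (intro integrable_norm Bochner_Integration.integrable_diff i fin)
    have "(t k - t (k - 1)) * c k = (\<integral>r. c k \<partial>?M)"
      using t[OF k] by (simp add: measure_restrict_space)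
    also have "\<dots> \<le> (\<integral>r. f r + norm (F r - F' k) \<partial>?M)"
      using le[OF k] by (intro integral_mono Bochner_Integration.integrable_add i n fin) simp
    also have "\<dots> = (\<integral>r. f r \<partial>?M) + (\<integral>r. norm (F r - F' k) \<partial>?M)"
      using i n by simp
    finally show ?thesis .
  qed
  then have "(\<Sum>k=1..n. (t k - t (k - 1)) * c k)
      \<le> (\<Sum>k=1..n. (\<integral>r. f r \<partial>lebesgue_on {t (k - 1)<..<t k})
        + (\<integral>r. norm (F r - F' k) \<partial>lebesgue_on {t (k - 1)<..<t k}))"
    by (rule sum_mono)
  then show ?thesis
    using sum_integral_cells[OF t int(1)] by (simp add: sum.distrib)
qed

subsection \<open>Comparison of solutions\<close>

lemma integral_lebesgue_on_mono_set:
  fixes f :: "'a::euclidean_space \<Rightarrow> real"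
  assumes f: "integrable (lebesgue_on S) f" "\<And>x. x \<in> S \<Longrightarrow> 0 \<le> f x"
    and S: "S' \<subseteq> S" "S \<in> sets lebesgue" "S' \<in> sets lebesgue"
  shows "(\<integral>x. f x \<partial>lebesgue_on S') \<le> (\<integral>x. f x \<partial>lebesgue_on S)"
proof -
  have "(\<integral>x. indicator S' x *\<^sub>R f x \<partial>lebesgue) \<le> (\<integral>x. indicator S x *\<^sub>R f x \<partial>lebesgue)"
  proof (rule integral_mono)
    show "integrable lebesgue (\<lambda>x. indicator S x *\<^sub>R f x)"
      using f S by (simp add: integrable_restrict_space)
    show "integrable lebesgue (\<lambda>x. indicator S' x *\<^sub>R f x)"
      using integrable_lebesgue_on_subset[OF f(1) S] S by (simp add: integrable_restrict_space)
    show "indicator S' x *\<^sub>R f x \<le> indicator S x *\<^sub>R f x" for x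
      using f(2)[of x] S(1) by (auto simp: indicator_def)
  qed
  then show ?thesis
    using S by (simp add: integral_restrict_space)
qed

text \<open>The estimate on two grids speaks of nodes only, so an arbitrary time is first moved to
  one. The last node not beyond \<open>r\<close> serves: either the next node lies beyond
  \<open>r\<close> and one step away, or the node is the final one and \<open>r = T\<close>.\<close>

lemma eps_solution_node_below:
  assumes "eps_solution X \<A> F T \<epsilon> n t F' s" "r \<in> {0..T}" "0 < \<epsilon>"
  obtains i where "i \<le> n" "t i \<le> r" "r - t i \<le> \<epsilon>"
proof -
  have t: "t 0 = 0" "t n = T" "\<And>j. j \<in> {1..n} \<Longrightarrow> t j - t (j - 1) \<le> \<epsilon>"
    using assms(1) unfolding eps_solution_def by blast+
  define I where "I = {i. i \<le> n \<and> t i \<le> r}"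
  have I: "finite I" "0 \<in> I" using assms(2) t by (auto simp: I_def)
  define i where "i = Max I"
  have i: "i \<in> I" unfolding i_def using I by (intro Max_in) auto
  have "r - t i \<le> \<epsilon>"
  proof (cases "i = n")
    case True
    then show ?thesis using i t(2) assms(2,3) by (simp add: I_def)
  next
    case False
    then have "Suc i \<le> n" using i by (simp add: I_def)
    moreover have "Suc i \<notin> I" using Max_ge[OF I(1), of "Suc i"] by (auto simp: i_def[symmetric])
    ultimately show ?thesis using t(3)[of "Suc i"] by (simp add: I_def)
  qed
  then show ?thesis using that i by (auto simp: I_def)
qed

lemma eps_solution_nodes:
  assumes "eps_solution X \<A> F T \<epsilon> n t F' s" "i \<le> n"
  shows "t i \<in> {0..T}"
proof -
  have t: "t 0 = 0" "t n = T" "\<And>j. j \<in> {1..n} \<Longrightarrow> t (j - 1) < t j"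
    using assms(1) unfolding eps_solution_def by blast+
  have mono: "t l \<le> t m" if "l \<le> m" "m \<le> n" for l m
    using that
  proof (induction m)
    case (Suc m)
    then show ?case using t(3)[of "Suc m"] by (cases "l = Suc m") auto
  qed simp
  show ?thesis using mono[of 0 i] mono[of i n] assms(2) t by simp
qed

lemma (in sublinear_functional) integrable_comp_diff:
  assumes "integrable M f" "integrable M g"
  shows "integrable M (\<lambda>x. p (f x - g x))"
proof (rule Bochner_Integration.integrable_bound[of _ "\<lambda>x. norm (f x - g x)"])
  have [measurable]: "f \<in> borel_measurable M" "g \<in> borel_measurable M"
    using assms by auto
  show "(\<lambda>x. p (f x - g x)) \<in> borel_measurable M" by measurable
qed (use assms nonneg le_norm in auto)

text \<open>The source \<open>p (F' k - H' l)\<close> couples the two grids. Inserting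
  \<open>\<Phi>\<close> at both nodes splits it into a part in k, a part in l and an increment of
  \<open>\<Phi>\<close>, at most \<open>\<eta>\<close> near the diagonal. The part in k sums up to
  the integral of \<open>p (F r - H r)\<close> with small errors, the part in l is small
  altogether.\<close>

lemma (in sublinear_functional) accretive_eps_solutions_le:
  assumes acc: "accretive \<A>"
    and F: "integrable (lebesgue_on {0<..<T}) F" and H: "integrable (lebesgue_on {0<..<T}) H"
    and su: "eps_solution X \<A> F T \<epsilon> m t F' x" and sv: "eps_solution Y \<A> H T \<epsilon> n t' H' y"
    and \<Phi>: "continuous_on UNIV \<Phi>" "integrable (lebesgue_on {0<..<T}) \<Phi>"
      "(\<integral>r. norm (H r - \<Phi> r) \<partial>lebesgue_on {0<..<T}) \<le> \<eta>"
    and C: "\<And>r s. r \<in> {0..T} \<Longrightarrow> s \<in> {0..T} \<Longrightarrow> p (x r - y s) \<le> C"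
    and w: "0 < w" "\<epsilon> \<le> w" "\<And>r s. r \<in> {0..T} \<Longrightarrow> s \<in> {0..T} \<Longrightarrow> \<bar>r - s\<bar> \<le> w \<Longrightarrow> norm (\<Phi> r - \<Phi> s) \<le> \<eta>"
    and B: "0 \<le> B" "\<And>r. r \<in> {0..T} \<Longrightarrow> r < w \<Longrightarrow> p (x r - y 0) \<le> B"
      "\<And>r. r \<in> {0..T} \<Longrightarrow> r < w \<Longrightarrow> p (x 0 - y r) \<le> B"
    and \<epsilon>: "0 < \<epsilon>" "\<epsilon> \<le> \<eta>" "2 * \<epsilon> * (C / w\<^sup>2) \<le> \<eta>" and \<eta>: "0 < \<eta>"
    and i: "i \<le> m" and j: "j \<le> n"
  shows "p (x (t i) - y (t' j)) \<le> B + (\<integral>r. p (F r - H r) \<partial>lebesgue_on {0<..<t i})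
    + (4 + 4 * T) * \<eta> + C / w\<^sup>2 * (t i - t' j)\<^sup>2"
proof -
  have t: "t 0 = 0" "t m = T" "\<And>k. k \<in> {1..m} \<Longrightarrow> t (k - 1) < t k \<and> t k - t (k - 1) \<le> \<epsilon>"
    and Fsum: "(\<Sum>k=1..m. \<integral>r. norm (F r - F' k) \<partial>lebesgue_on {t (k - 1)<..<t k}) < \<epsilon>"
    and xs: "\<And>k. k \<in> {1..m} \<Longrightarrow> \<exists>f\<in>\<A> (x (t k)). (x (t k) - x (t (k - 1))) /\<^sub>R (t k - t (k - 1)) + f = F' k"
    using su unfolding eps_solution_def by blast+
  have t': "t' 0 = 0" "t' n = T" "\<And>k. k \<in> {1..n} \<Longrightarrow> t' (k - 1) < t' k \<and> t' k - t' (k - 1) \<le> \<epsilon>"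
    and Hsum: "(\<Sum>k=1..n. \<integral>r. norm (H r - H' k) \<partial>lebesgue_on {t' (k - 1)<..<t' k}) < \<epsilon>"
    and ys: "\<And>k. k \<in> {1..n} \<Longrightarrow> \<exists>f\<in>\<A> (y (t' k)). (y (t' k) - y (t' (k - 1))) /\<^sub>R (t' k - t' (k - 1)) + f = H' k"
    using sv unfolding eps_solution_def by blast+
  note tT = eps_solution_nodes[OF su] and tT' = eps_solution_nodes[OF sv]
  have "T \<ge> 0" using tT[of 0] by simp
  have C0: "0 \<le> C" using C[of 0 0] nonneg[of "x 0 - y 0"] \<open>T \<ge> 0\<close> by simp
  define \<gamma> where "\<gamma> k = p (F' k - \<Phi> (t k))" for k
  define e where "e k = norm (H' k - \<Phi> (t' k))" for k
  define h where "h k l = p (F' k - H' l)" for k l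
  have sub': "integrable (lebesgue_on {0<..<s}) f" if "integrable (lebesgue_on {0<..<T}) f" "s \<le> T"
    for f :: "real \<Rightarrow> real" and s
    using that by (intro integrable_lebesgue_on_subset[OF that(1)]) auto
  have subb: "integrable (lebesgue_on {0<..<s}) f" if "integrable (lebesgue_on {0<..<T}) f" "s \<le> T"
    for f :: "real \<Rightarrow> 'b" and s
    using that by (intro integrable_lebesgue_on_subset[OF that(1)]) auto
  have pFH: "integrable (lebesgue_on {0<..<T}) (\<lambda>r. p (F r - H r))"
    by (rule integrable_comp_diff[OF F H])
  have nH: "integrable (lebesgue_on {0<..<T}) (\<lambda>r. norm (H r - \<Phi> r))"
    using H \<Phi> by auto
  have const: "integrable (lebesgue_on {0<..<s}) (\<lambda>r. \<eta>)" for s :: real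
    by (intro finite_measure.integrable_const finite_measure_lebesgue_on) simp
  have int_const: "(\<integral>r. \<eta> \<partial>lebesgue_on {0<..<s}) \<le> T * \<eta>" if "s \<in> {0..T}" for s
    using that \<eta> by (simp add: measure_restrict_space mult_right_mono)
  have int_\<Phi>: "(\<integral>r. norm (H r - \<Phi> r) \<partial>lebesgue_on {0<..<s}) \<le> \<eta>" if "s \<in> {0..T}" for s
  proof -
    have "(\<integral>r. norm (H r - \<Phi> r) \<partial>lebesgue_on {0<..<s}) \<le> (\<integral>r. norm (H r - \<Phi> r) \<partial>lebesgue_on {0<..<T})"
      using that by (intro integral_lebesgue_on_mono_set nH) auto
    then show ?thesis using \<Phi>(3) by simp
  qed
  have sum\<gamma>: "(\<Sum>k=1..i. (t k - t (k - 1)) * \<gamma> k)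
      \<le> (\<integral>r. p (F r - H r) \<partial>lebesgue_on {0<..<t i}) + \<eta> + T * \<eta> + \<epsilon>"
  proof -
    have ti: "t i \<in> {0..T}" using tT i by simp
    let ?M = "lebesgue_on {0<..<t i}"
    have ints: "integrable ?M (\<lambda>r. p (F r - H r))" "integrable ?M (\<lambda>r. norm (H r - \<Phi> r))" "integrable ?M F"
      using ti by (auto intro: sub'[OF pFH] sub'[OF nH] subb[OF F])
    have "(\<Sum>k=1..i. (t k - t (k - 1)) * \<gamma> k)
      \<le> (\<integral>r. p (F r - H r) + norm (H r - \<Phi> r) + \<eta> \<partial>lebesgue_on {t 0<..<t i})
        + (\<Sum>k=1..i. \<integral>r. norm (F r - F' k) \<partial>lebesgue_on {t (k - 1)<..<t k})"
    proof (rule sum_le_integral_cells)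
      show "t (k - 1) \<le> t k" if "k \<in> {1..i}" for k
        using t(3)[of k] that i by auto
      fix k r assume k: "k \<in> {1..i}" and r: "r \<in> {t (k - 1)<..<t k}"
      have rT: "r \<in> {0..T}" "t k \<in> {0..T}" "\<bar>r - t k\<bar> \<le> w"
        using tT[of k] tT[of "k - 1"] t(3)[of k] i k r w(2) by auto linarith+
      \<comment> \<open>Only \<open>F r - H r\<close> is measured by \<open>p\<close>. The three
        errors, from the approximation in L^1, the modulus of \<open>\<Phi>\<close> and the
        discretization of \<open>F\<close>, are measured by the norm.\<close>
      have "F' k - \<Phi> (t k) = (F r - H r) + ((H r - \<Phi> r) + ((\<Phi> r - \<Phi> (t k)) + (F' k - F r)))"
        by simp
      also have "p \<dots> \<le> p (F r - H r) + (norm (H r - \<Phi> r) + (norm (\<Phi> r - \<Phi> (t k)) + norm (F' k - F r)))"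
        by (intro add_le[THEN order_trans] add_mono order_refl le_norm)
      finally show "\<gamma> k \<le> p (F r - H r) + norm (H r - \<Phi> r) + \<eta> + norm (F r - F' k)"
        using w(3)[OF rT] by (simp add: \<gamma>_def norm_minus_commute)
    qed (use ints const t(1) in auto)
    also have "(\<integral>r. p (F r - H r) + norm (H r - \<Phi> r) + \<eta> \<partial>lebesgue_on {t 0<..<t i})
      = (\<integral>r. p (F r - H r) \<partial>?M) + (\<integral>r. norm (H r - \<Phi> r) \<partial>?M) + (\<integral>r. \<eta> \<partial>?M)"
      using ints const t(1) by simp
    also have "(\<Sum>k=1..i. \<integral>r. norm (F r - F' k) \<partial>lebesgue_on {t (k - 1)<..<t k})
      \<le> (\<Sum>k=1..m. \<integral>r. norm (F r - F' k) \<partial>lebesgue_on {t (k - 1)<..<t k})"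
      using i by (intro sum_mono2) auto
    finally show ?thesis
      using int_const[OF ti] int_\<Phi>[OF ti] Fsum by simp
  qed
  have sume: "(\<Sum>k=1..j. (t' k - t' (k - 1)) * e k) \<le> \<eta> + T * \<eta> + \<epsilon>"
  proof -
    have tj: "t' j \<in> {0..T}" using tT' j by simp
    let ?M = "lebesgue_on {0<..<t' j}"
    have ints: "integrable ?M (\<lambda>r. norm (H r - \<Phi> r))" "integrable ?M H"
      using tj by (auto intro: sub'[OF nH] subb[OF H])
    have "(\<Sum>k=1..j. (t' k - t' (k - 1)) * e k)
      \<le> (\<integral>r. norm (H r - \<Phi> r) + \<eta> \<partial>lebesgue_on {t' 0<..<t' j})
        + (\<Sum>k=1..j. \<integral>r. norm (H r - H' k) \<partial>lebesgue_on {t' (k - 1)<..<t' k})"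
    proof (rule sum_le_integral_cells)
      show "t' (k - 1) \<le> t' k" if "k \<in> {1..j}" for k
        using t'(3)[of k] that j by auto
      fix k r assume k: "k \<in> {1..j}" and r: "r \<in> {t' (k - 1)<..<t' k}"
      have rT: "r \<in> {0..T}" "t' k \<in> {0..T}" "\<bar>r - t' k\<bar> \<le> w"
        using tT'[of k] tT'[of "k - 1"] t'(3)[of k] j k r w(2) by auto linarith+
      have "H' k - \<Phi> (t' k) = (H r - \<Phi> r) + ((\<Phi> r - \<Phi> (t' k)) + (H' k - H r))"
        by simp
      also have "norm \<dots> \<le> norm (H r - \<Phi> r) + (norm (\<Phi> r - \<Phi> (t' k)) + norm (H' k - H r))"
        by (intro norm_triangle_ineq[THEN order_trans] add_mono order_refl)
      finally show "e k \<le> norm (H r - \<Phi> r) + \<eta> + norm (H r - H' k)"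
        using w(3)[OF rT] by (simp add: e_def norm_minus_commute)
    qed (use ints const t'(1) in auto)
    also have "(\<integral>r. norm (H r - \<Phi> r) + \<eta> \<partial>lebesgue_on {t' 0<..<t' j})
      = (\<integral>r. norm (H r - \<Phi> r) \<partial>?M) + (\<integral>r. \<eta> \<partial>?M)"
      using ints const t'(1) by simp
    also have "(\<Sum>k=1..j. \<integral>r. norm (H r - H' k) \<partial>lebesgue_on {t' (k - 1)<..<t' k})
      \<le> (\<Sum>k=1..n. \<integral>r. norm (H r - H' k) \<partial>lebesgue_on {t' (k - 1)<..<t' k})"
      using j by (intro sum_mono2) auto
    finally show ?thesis
      using int_const[OF tj] int_\<Phi>[OF tj] Hsum by simp
  qed
  \<comment> \<open>Here \<open>\<kappa> = \<eta>\<close> bounds the increment of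
    \<open>\<Phi>\<close>, and \<open>\<kappa>' = 2 * \<eta>\<close> also covers
    \<open>2 * \<epsilon> * (C / w\<^sup>2)\<close>. The sums over \<open>\<gamma>\<close> and
    \<open>e\<close> contribute errors \<open>2 * \<eta> + 2 * T * \<eta> + 2 * \<epsilon>\<close>
    and the linear term at most \<open>2 * T * \<eta>\<close>; as
    \<open>\<epsilon> \<le> \<eta>\<close>, this makes \<open>(4 + 4 * T) * \<eta>\<close>.\<close>
  have "p (x (t i) - y (t' j)) \<le> B + (\<Sum>k=1..i. (t k - t (k - 1)) * \<gamma> k)
      + (\<Sum>k=1..j. (t' k - t' (k - 1)) * e k) + (2 * \<eta>) * (t i - t 0) + C / w\<^sup>2 * (t i - t' j)\<^sup>2"
  proof (rule discrete_comparison[where h = h and m = m and n = n and \<epsilon> = \<epsilon> and \<kappa> = \<eta>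
      and a = "\<lambda>i j. p (x (t i) - y (t' j))"])
    fix k l assume k: "k \<in> {1..m}" and l: "l \<in> {1..n}"
    show "((t k - t (k - 1)) + (t' l - t' (l - 1))) * p (x (t k) - y (t' l))
      \<le> (t' l - t' (l - 1)) * p (x (t (k - 1)) - y (t' l)) + (t k - t (k - 1)) * p (x (t k) - y (t' (l - 1)))
        + (t k - t (k - 1)) * (t' l - t' (l - 1)) * h k l"
      using xs[OF k] ys[OF l] t(3)[OF k] t'(3)[OF l]
      unfolding h_def by (blast intro: accretive_implicit_steps[OF acc] diff_gt_0_iff_gt[THEN iffD2])
    assume near: "\<bar>t k - t' l\<bar> < w"
    have "F' k - H' l = (F' k - \<Phi> (t k)) + ((\<Phi> (t k) - \<Phi> (t' l)) + (\<Phi> (t' l) - H' l))"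
      by simp
    also have "p \<dots> \<le> p (F' k - \<Phi> (t k)) + (norm (\<Phi> (t k) - \<Phi> (t' l)) + norm (\<Phi> (t' l) - H' l))"
      by (intro add_le[THEN order_trans] add_mono order_refl le_norm)
    finally show "h k l \<le> \<gamma> k + e l + \<eta>"
      using w(3)[of "t k" "t' l"] tT[of k] tT'[of l] k l near
      by (simp add: h_def \<gamma>_def e_def norm_minus_commute)
  next
    show "p (x (t 0) - y (t' l)) \<le> B" if "l \<le> n" "\<bar>t 0 - t' l\<bar> < w" for l
      using that B(3)[of "t' l"] tT'[of l] t(1) by auto
    show "p (x (t k) - y (t' 0)) \<le> B" if "k \<le> m" "\<bar>t k - t' 0\<bar> < w" for k
      using that B(2)[of "t k"] tT[of k] t'(1) by auto
  qed (use t(3) t'(3) C C0 tT tT' w(1) B(1) \<epsilon> \<eta> i j nonneg in \<open>auto simp: \<gamma>_def e_def\<close>)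
  moreover have "(2 * \<eta>) * (t i - t 0) \<le> (2 * \<eta>) * T"
    using tT[OF i] t(1) \<eta> by (intro mult_left_mono) auto
  moreover have "(4 + 4 * T) * \<eta> = 4 * \<eta> + 4 * (T * \<eta>)" "(2 * \<eta>) * T = 2 * (T * \<eta>)"
    by (auto simp: algebra_simps)
  ultimately show ?thesis
    using sum\<gamma> sume \<epsilon>(2) by linarith
qed

text \<open>The parameters are chosen in the order \<open>\<eta>\<close>, \<open>\<Phi>\<close>,
  \<open>w\<close>, \<open>C\<close>, \<open>\<epsilon>\<close>. The penalty coefficient
  \<open>C / w\<^sup>2\<close> is thus fixed before the mesh is refined, and the penalty at two
  nodes close to \<open>r\<close> becomes negligible.\<close>

lemma (in sublinear_functional) accretive_C0_solutions_le:
  assumes acc: "accretive \<A>"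
    and u: "C0_solution X \<A> F T u0 u" and v: "C0_solution Y \<A> H T v0 v"
    and F: "integrable (lebesgue_on {0<..<T}) F" and H: "integrable (lebesgue_on {0<..<T}) H"
    and r: "r \<in> {0..T}"
  shows "p (u r - v r) \<le> p (u 0 - v 0) + (\<integral>s. p (F s - H s) \<partial>lebesgue_on {0<..<r})"
proof (rule field_le_epsilon)
  fix e :: real assume "0 < e"
  have T: "0 \<le> T" using r by simp
  \<comment> \<open>The budget: \<open>4 * \<eta>\<close> for the initial values,
    \<open>4 * \<eta>\<close> for passing from \<open>r\<close> to the nodes,
    \<open>(4 + 4 * T) * \<eta>\<close> from \<open>accretive_eps_solutions_le\<close> and one
    \<open>\<eta>\<close> for the penalty.\<close>
  define \<eta> where "\<eta> = e / (13 + 4 * T)"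
  have "\<eta> \<le> e / (13 + 4 * T)" by (simp add: \<eta>_def)
  then have "(13 + 4 * T) * \<eta> \<le> e"
    using T by (simp add: pos_le_divide_eq mult.commute)
  then have \<eta>: "0 < \<eta>" "(13 + 4 * T) * \<eta> \<le> e"
    using \<open>0 < e\<close> T by (auto simp: \<eta>_def)
  obtain \<Phi> where \<Phi>: "continuous_on UNIV \<Phi>" "integrable (lebesgue_on {0<..<T}) \<Phi>"
      "(\<integral>r. norm (H r - \<Phi> r) \<partial>lebesgue_on {0<..<T}) < \<eta>"
    using integrable_lebesgue_on_continuous_approx[OF H _ \<eta>(1)] by auto
  have cont: "continuous_on {0..T} u" "continuous_on {0..T} v" "continuous_on {0..T} \<Phi>"
    using u v continuous_on_subset[OF \<Phi>(1)] by (auto simp: C0_solution_def)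
  have uc: "\<exists>w>0. \<forall>r\<in>{0..T}. \<forall>s\<in>{0..T}. \<bar>r - s\<bar> \<le> w \<longrightarrow> norm (f r - f s) \<le> \<eta>"
    if f: "continuous_on {0..T} f" for f :: "real \<Rightarrow> 'b"
  proof -
    obtain d where d: "d > 0" "\<And>r s. r \<in> {0..T} \<Longrightarrow> s \<in> {0..T} \<Longrightarrow> dist s r < d \<Longrightarrow> dist (f s) (f r) < \<eta>"
      using compact_uniformly_continuous[OF f compact_Icc] \<eta>(1)
      unfolding uniformly_continuous_on_def by metis
    show ?thesis
      using d(1) d(2)[of _ "_::real"]
      by (intro exI[of _ "d/2"]) (auto simp: dist_norm intro!: less_imp_le)
  qed
  obtain w1 w2 w3 where w123: "w1 > 0" "w2 > 0" "w3 > 0"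
    "\<forall>r\<in>{0..T}. \<forall>s\<in>{0..T}. \<bar>r - s\<bar> \<le> w1 \<longrightarrow> norm (u r - u s) \<le> \<eta>"
    "\<forall>r\<in>{0..T}. \<forall>s\<in>{0..T}. \<bar>r - s\<bar> \<le> w2 \<longrightarrow> norm (v r - v s) \<le> \<eta>"
    "\<forall>r\<in>{0..T}. \<forall>s\<in>{0..T}. \<bar>r - s\<bar> \<le> w3 \<longrightarrow> norm (\<Phi> r - \<Phi> s) \<le> \<eta>"
    using uc[OF cont(1)] uc[OF cont(2)] uc[OF cont(3)] by blast
  define w where "w = min w1 (min w2 w3)"
  have w: "0 < w" using w123 by (simp add: w_def)
  have wu: "norm (u r - u s) \<le> \<eta>" and wv: "norm (v r - v s) \<le> \<eta>" and w\<Phi>: "norm (\<Phi> r - \<Phi> s) \<le> \<eta>"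
    if "r \<in> {0..T}" "s \<in> {0..T}" "\<bar>r - s\<bar> \<le> w" for r s
    using w123 that by (auto simp: w_def)
  have bd: "\<exists>C. \<forall>r\<in>{0..T}. norm (f r) \<le> C" if f: "continuous_on {0..T} f" for f :: "real \<Rightarrow> 'b"
    using compact_imp_bounded[OF compact_continuous_image[OF f compact_Icc]]
    by (auto simp: bounded_iff)
  obtain Cu Cv where Cu: "\<And>r. r \<in> {0..T} \<Longrightarrow> norm (u r) \<le> Cu"
    and Cv: "\<And>r. r \<in> {0..T} \<Longrightarrow> norm (v r) \<le> Cv"
    using bd[OF cont(1)] bd[OF cont(2)] by blast
  \<comment> \<open>The summand 2 allows for the step functions, each within
    \<open>\<epsilon> \<le> 1\<close> of its solution, so that \<open>C\<close> does not depend on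
    \<open>\<epsilon>\<close>.\<close>
  define C where "C = Cu + Cv + 2"
  have "norm (u 0) \<le> Cu" "norm (v 0) \<le> Cv"
    using Cu[of 0] Cv[of 0] T by auto
  then have C: "0 \<le> C"
    using norm_ge_zero[of "u 0"] norm_ge_zero[of "v 0"] unfolding C_def by linarith
  define q where "q = C / w\<^sup>2"
  have q: "0 \<le> q" using C by (simp add: q_def)
  \<comment> \<open>The last bound yields \<open>2 * \<epsilon> * q \<le> \<eta>\<close>; adding 1
    to \<open>q\<close> makes the denominator positive on the strength of
    \<open>0 \<le> q\<close>.\<close>
  define \<epsilon> where "\<epsilon> = min (min 1 \<eta>) (min w (\<eta> / (2 * (q + 1))))"
  have \<epsilon>: "0 < \<epsilon>" "\<epsilon> \<le> \<eta>" "\<epsilon> \<le> w" "\<epsilon> \<le> 1"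
    using w \<eta> q by (auto simp: \<epsilon>_def)
  have "\<epsilon> * (2 * (q + 1)) \<le> \<eta>"
    using q by (subst pos_le_divide_eq[symmetric]) (auto simp: \<epsilon>_def)
  then have \<epsilon>q: "2 * \<epsilon> * q \<le> \<eta>"
    using \<epsilon>(1) by (simp add: algebra_simps)
  obtain m t F' x where su: "eps_solution X \<A> F T \<epsilon> m t F' x" and ux: "\<And>r. r \<in> {0..T} \<Longrightarrow> norm (u r - x r) \<le> \<epsilon>"
    using u \<epsilon>(1) unfolding C0_solution_def by meson
  obtain n t' H' y where sv: "eps_solution Y \<A> H T \<epsilon> n t' H' y" and vy: "\<And>r. r \<in> {0..T} \<Longrightarrow> norm (v r - y r) \<le> \<epsilon>"
    using v \<epsilon>(1) unfolding C0_solution_def by meson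
  obtain i where i: "i \<le> m" "t i \<le> r" "r - t i \<le> \<epsilon>"
    using eps_solution_node_below[OF su r \<epsilon>(1)] .
  obtain j where j: "j \<le> n" "t' j \<le> r" "r - t' j \<le> \<epsilon>"
    using eps_solution_node_below[OF sv r \<epsilon>(1)] .
  note tT = eps_solution_nodes[OF su i(1)] eps_solution_nodes[OF sv j(1)]
  have move: "p (a - b) \<le> p (a' - b') + (norm (a - a') + norm (b - b'))" for a a' b b'
  proof -
    have "norm ((a - b) - (a' - b')) \<le> norm (a - a') + norm (b - b')"
      using norm_triangle_ineq4[of "a - a'" "b - b'"] by (simp add: algebra_simps)
    then show ?thesis using le_add_norm[of "a - b" "a' - b'"] by simp
  qed
  \<comment> \<open>One \<open>\<eta>\<close> is the oscillation of \<open>u\<close> over a distance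
    \<open>w\<close>, the other covers the approximation error \<open>\<epsilon>\<close>.\<close>
  have near_x: "norm (u s - x s') \<le> 2 * \<eta>" "norm (x s' - u s) \<le> 2 * \<eta>"
    if "s \<in> {0..T}" "s' \<in> {0..T}" "\<bar>s - s'\<bar> \<le> w" for s s'
    using norm_triangle_ineq[of "u s - u s'" "u s' - x s'"] wu[OF that] ux[OF that(2)] \<epsilon>(2)
    by (auto simp: norm_minus_commute)
  have near_y: "norm (v s - y s') \<le> 2 * \<eta>" "norm (y s' - v s) \<le> 2 * \<eta>"
    if "s \<in> {0..T}" "s' \<in> {0..T}" "\<bar>s - s'\<bar> \<le> w" for s s'
    using norm_triangle_ineq[of "v s - v s'" "v s' - y s'"] wv[OF that] vy[OF that(2)] \<epsilon>(2)
    by (auto simp: norm_minus_commute)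
  have "p (x (t i) - y (t' j)) \<le> (p (u 0 - v 0) + 4 * \<eta>) + (\<integral>r. p (F r - H r) \<partial>lebesgue_on {0<..<t i})
    + (4 + 4 * T) * \<eta> + C / w\<^sup>2 * (t i - t' j)\<^sup>2"
  proof (rule accretive_eps_solutions_le[OF acc F H su sv \<Phi>(1,2) less_imp_le[OF \<Phi>(3)]])
    fix r s assume rs: "r \<in> {0..T}" "s \<in> {0..T}"
    have "p (x r - y s) \<le> norm (x r) + norm (y s)"
      using le_norm[of "x r - y s"] norm_triangle_ineq4[of "x r" "y s"] by simp
    also have "norm (x r) \<le> Cu + 1"
      using ux[OF rs(1)] Cu[OF rs(1)] \<epsilon>(4) norm_triangle_ineq4[of "u r" "u r - x r"] by simp
    also have "norm (y s) \<le> Cv + 1"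
      using vy[OF rs(2)] Cv[OF rs(2)] \<epsilon>(4) norm_triangle_ineq4[of "v s" "v s - y s"] by simp
    finally show "p (x r - y s) \<le> C" by (simp add: C_def)
  next
    fix r assume rs: "r \<in> {0..T}" "r < w"
    show "p (x r - y 0) \<le> p (u 0 - v 0) + 4 * \<eta>"
      using move[of "x r" "y 0" "u 0" "v 0"] near_x(2)[of 0 r] near_y(2)[of 0 0] rs T w by simp
    show "p (x 0 - y r) \<le> p (u 0 - v 0) + 4 * \<eta>"
      using move[of "x 0" "y r" "u 0" "v 0"] near_x(2)[of 0 0] near_y(2)[of 0 r] rs T w by simp
  qed (use w w\<Phi> \<epsilon> \<epsilon>q \<eta> i j nonneg[of "u 0 - v 0"] in \<open>auto simp: q_def\<close>)
  moreover have "p (u r - v r) \<le> p (x (t i) - y (t' j)) + 4 * \<eta>"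
    using move[of "u r" "v r" "x (t i)" "y (t' j)"] near_x(1)[of r "t i"] near_y(1)[of r "t' j"] tT i j r \<epsilon>(3)
    by simp
  moreover have "C / w\<^sup>2 * (t i - t' j)\<^sup>2 \<le> \<eta>"
  proof -
    \<comment> \<open>Both nodes lie in the interval from \<open>r - \<epsilon>\<close> to
      \<open>r\<close>; with \<open>\<epsilon> \<le> 1\<close> the squared distance is at most
      \<open>\<epsilon>\<close>.\<close>
    have "\<bar>t i - t' j\<bar> \<le> \<epsilon>" using i j by simp
    then have "(t i - t' j)\<^sup>2 \<le> \<epsilon> * 1"
      using \<epsilon> mult_mono[of "\<bar>t i - t' j\<bar>" \<epsilon> "\<bar>t i - t' j\<bar>" 1] by (simp add: power2_eq_square)
    then have "q * (t i - t' j)\<^sup>2 \<le> q * \<epsilon>"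
      using q by (intro mult_left_mono) auto
    also have "\<dots> \<le> 2 * \<epsilon> * q"
      using q \<epsilon>(1) by simp
    finally show ?thesis using \<epsilon>q by (simp add: q_def)
  qed
  moreover have "(\<integral>r. p (F r - H r) \<partial>lebesgue_on {0<..<t i}) \<le> (\<integral>s. p (F s - H s) \<partial>lebesgue_on {0<..<r})"
  proof -
    have FH: "integrable (lebesgue_on {0<..<r}) F" "integrable (lebesgue_on {0<..<r}) H"
      using r by (auto intro!: integrable_lebesgue_on_subset[OF F] integrable_lebesgue_on_subset[OF H])
    have pFH: "integrable (lebesgue_on {0<..<r}) (\<lambda>r. p (F r - H r))"
      by (rule integrable_comp_diff[OF FH])
    show ?thesis
      using i(2) r nonneg by (intro integral_lebesgue_on_mono_set pFH) auto
  qed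
  ultimately have "p (u r - v r) \<le> p (u 0 - v 0) + (\<integral>s. p (F s - H s) \<partial>lebesgue_on {0<..<r}) + (13 + 4 * T) * \<eta>"
    by (simp add: algebra_simps)
  then show "p (u r - v r) \<le> p (u 0 - v 0) + (\<integral>s. p (F s - H s) \<partial>lebesgue_on {0<..<r}) + e"
    using \<eta>(2) by simp
qed

subsection \<open>Accretivity of the composite relation in \<open>L\<^sup>1\<close>\<close>

lemma l1_fun_measurable [measurable]: "l1_fun f \<in> borel_measurable lebesgue"
  by (rule borel_measurable_integrable[OF l1_fun_integrable])

lemma norm_l1_fun: "norm f = (\<integral>x. \<bar>l1_fun f x\<bar> \<partial>lebesgue)"
  using norm_l1_class[OF l1_fun_integrable[of f]] by (simp add: l1_class_l1_fun)

lemma l1_pos_eq: "l1_pos f = l1_class (\<lambda>x. max (l1_fun f x) 0)"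
  using l1_pos.abs_eq[of "l1_fun f"] by (simp add: l1_rel_def l1_fun_integrable l1_class_l1_fun)

lemma norm_l1_pos: "norm (l1_pos f) = (\<integral>x. max (l1_fun f x) 0 \<partial>lebesgue)"
proof -
  have i: "integrable lebesgue (\<lambda>x. max (l1_fun f x) 0)"
    using l1_fun_integrable[of f] by simp
  show ?thesis
    unfolding l1_pos_eq using i by (simp add: norm_l1_class)
qed

lemma l1_neg_eq: "l1_neg f = l1_pos (- f)"
  by transfer (auto simp: l1_rel_def)

lemma norm_eq_pos_neg: "norm f = norm (l1_pos f) + norm (l1_neg f)"
proof -
  have "l1_fun (- f) = l1_fun ((- 1) *\<^sub>R f)" by simp
  then have ae: "AE x in lebesgue. l1_fun (- f) x = - l1_fun f x"
    using l1_fun_scaleR[of "- 1" f] by simp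
  have "norm (l1_neg f) = (\<integral>x. max (- l1_fun f x) 0 \<partial>lebesgue)"
    unfolding l1_neg_eq norm_l1_pos
    using ae l1_fun_integrable[of f] l1_fun_integrable[of "- f"]
    by (intro integral_cong_AE) auto
  then have "norm (l1_pos f) + norm (l1_neg f) = (\<integral>x. max (l1_fun f x) 0 + max (- l1_fun f x) 0 \<partial>lebesgue)"
    using l1_fun_integrable[of f] by (simp add: norm_l1_pos)
  also have "\<dots> = norm f"
    unfolding norm_l1_fun by (intro Bochner_Integration.integral_cong) auto
  finally show ?thesis by simp
qed

lemma sublinear_norm_l1_pos: "sublinear_functional (\<lambda>f. norm (l1_pos f))"
proof
  fix f g :: "'a l1" and c :: real
  note [simp] = l1_fun_integrable
  have "(\<integral>x. max (l1_fun (f + g) x) 0 \<partial>lebesgue) \<le> (\<integral>x. max (l1_fun f x) 0 + max (l1_fun g x) 0 \<partial>lebesgue)"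
    using l1_fun_add[of f g] by (intro integral_mono_AE) (auto elim!: eventually_mono)
  then show "norm (l1_pos (f + g)) \<le> norm (l1_pos f) + norm (l1_pos g)"
    by (simp add: norm_l1_pos)
  show "norm (l1_pos (c *\<^sub>R f)) = c * norm (l1_pos f)" if "0 \<le> c"
  proof -
    have "(\<integral>x. max (l1_fun (c *\<^sub>R f) x) 0 \<partial>lebesgue) = (\<integral>x. c * max (l1_fun f x) 0 \<partial>lebesgue)"
      using l1_fun_scaleR[of c f] that
      by (intro integral_cong_AE) (auto elim!: eventually_mono simp: max_mult_distrib_left)
    then show ?thesis by (simp add: norm_l1_pos)
  qed
  show "0 \<le> norm (l1_pos f)" by simp
  show "norm (l1_pos f) \<le> norm f"
    using norm_eq_pos_neg[of f] by simp
qed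

lemma l1_pos_in_l1_on: "f \<in> l1_on G \<Longrightarrow> l1_pos f \<in> l1_on G"
proof -
  assume f: "f \<in> l1_on G"
  show ?thesis
    unfolding l1_pos_eq using f by (simp add: l1_class_in_l1_on l1_fun_integrable) (auto simp: l1_on_def elim!: eventually_mono)
qed

lemma l1_diff_pos_nonpos: "AE x in lebesgue. l1_fun (f - l1_pos f) x \<le> 0"
proof -
  have "AE x in lebesgue. l1_fun (l1_pos f) x = max (l1_fun f x) 0"
    unfolding l1_pos_eq using l1_fun_l1_class[of "\<lambda>x. max (l1_fun f x) 0"] by (simp add: l1_fun_integrable)
  with l1_fun_diff[of f "l1_pos f"] show ?thesis
    by eventually_elim simp
qed

section \<open>Pairings of L^1 with functions valued in [0,1]\<close>

definition l1_pair :: "('a::euclidean_space \<Rightarrow> real) \<Rightarrow> 'a l1 \<Rightarrow> real" where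
  "l1_pair g f = (\<integral>x. g x * l1_fun f x \<partial>lebesgue)"

context
  fixes g :: "'a::euclidean_space \<Rightarrow> real"
  assumes g [measurable]: "g \<in> borel_measurable lebesgue" and g01: "\<And>x. 0 \<le> g x" "\<And>x. g x \<le> 1"
begin

lemma l1_pair_integrable: "integrable lebesgue (\<lambda>x. g x * l1_fun f x)"
proof (rule Bochner_Integration.integrable_bound[OF l1_fun_integrable[of f]])
  show "(\<lambda>x. g x * l1_fun f x) \<in> borel_measurable lebesgue" by measurable
  show "AE x in lebesgue. norm (g x * l1_fun f x) \<le> norm (l1_fun f x)"
    using g01 by (auto simp: abs_mult intro!: mult_left_le_one_le)
qed

lemma l1_pair_add: "l1_pair g (f + h) = l1_pair g f + l1_pair g h"
proof -
  have "l1_pair g (f + h) = (\<integral>x. g x * l1_fun f x + g x * l1_fun h x \<partial>lebesgue)"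
    unfolding l1_pair_def
    using l1_fun_add[of f h] l1_pair_integrable[of "f + h"] l1_pair_integrable[of f] l1_pair_integrable[of h]
    by (intro integral_cong_AE) (auto elim!: eventually_mono simp: algebra_simps)
  then show ?thesis
    using l1_pair_integrable by (simp add: l1_pair_def)
qed

lemma l1_pair_scaleR: "l1_pair g (c *\<^sub>R f) = c * l1_pair g f"
proof -
  have "l1_pair g (c *\<^sub>R f) = (\<integral>x. c * (g x * l1_fun f x) \<partial>lebesgue)"
    unfolding l1_pair_def
    using l1_fun_scaleR[of c f] l1_pair_integrable[of "c *\<^sub>R f"] l1_pair_integrable[of f]
    by (intro integral_cong_AE) (auto elim!: eventually_mono)
  then show ?thesis
    by (simp add: l1_pair_def)
qed

lemma l1_pair_diff: "l1_pair g (f - h) = l1_pair g f - l1_pair g h"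
  using l1_pair_add[of f "(- 1) *\<^sub>R h"] l1_pair_scaleR[of "- 1" h] by simp

text \<open>A factor in [0,1] cannot lift a value above its positive part. Together with
  \<open>l1_pair_eq_pos\<close> this exhibits the norm of the positive part as the largest such
  pairing, attained at the sections of sign^+ f.\<close>

lemma l1_pair_le_pos: "l1_pair g f \<le> norm (l1_pos f)"
  unfolding l1_pair_def norm_l1_pos
proof (rule integral_mono)
  show "g x * l1_fun f x \<le> max (l1_fun f x) 0" for x
    using g01[of x] mult_right_le_one_le[of "l1_fun f x" "g x"]
    by (cases "0 \<le> l1_fun f x") (auto simp: mult_nonneg_nonpos mult.commute)
qed (use l1_pair_integrable l1_fun_integrable[of f] in auto)

lemma l1_pair_le_norm: "l1_pair g f \<le> norm f"
  using l1_pair_le_pos[of f] norm_eq_pos_neg[of f] norm_ge_zero[of "l1_neg f"] by linarith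

lemma l1_pair_nonpos:
  assumes "AE x in lebesgue. l1_fun f x \<le> 0"
  shows "l1_pair g f \<le> 0"
proof -
  have "norm (l1_pos f) = 0"
    unfolding norm_l1_pos using assms by (intro integral_eq_zero_AE) (auto elim!: eventually_mono)
  then show ?thesis
    using l1_pair_le_pos[of f] by simp
qed

text \<open>Where \<open>f\<close> vanishes, \<open>g\<close> is unconstrained. This freedom later
  lets one \<open>g\<close> serve two functions at once.\<close>

lemma l1_pair_eq_pos:
  assumes "AE x in lebesgue. (0 < l1_fun f x \<longrightarrow> g x = 1) \<and> (l1_fun f x < 0 \<longrightarrow> g x = 0)"
  shows "l1_pair g f = norm (l1_pos f)"
  unfolding l1_pair_def norm_l1_pos
proof (rule integral_cong_AE)
  show "AE x in lebesgue. g x * l1_fun f x = max (l1_fun f x) 0"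
    using assms by eventually_elim (auto simp: max_def not_less)
qed (use l1_pair_integrable[of f] l1_fun_integrable[of f] in auto)

end

text \<open>For nonpositive \<open>f\<close> the upper bound in \<open>sup\<close> is 0, which
  controls the resolvent on \<open>G\<close>; off \<open>G\<close> it vanishes as an element of
  \<open>l1_on G\<close>. For a linear resolvent this is positivity.\<close>

lemma resolvent_nonpos:
  assumes "G \<in> sets lebesgue" "f \<in> l1_on G" "resolvent D A \<mu> f \<in> l1_on G"
    and sup: "ess_sup_on G (resolvent D A \<mu> f) \<le> max (ess_sup_on G f) 0"
    and f: "AE x in lebesgue. l1_fun f x \<le> 0"
  shows "AE x in lebesgue. l1_fun (resolvent D A \<mu> f) x \<le> 0"
proof -
  have [measurable]: "l1_fun h \<in> borel_measurable (lebesgue_on G)" for h :: "'a l1"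
    using l1_fun_integrable[of h] by (intro measurable_restrict_space1) auto
  have "ess_sup_on G f \<le> 0"
    unfolding ess_sup_on_def
  proof (rule esssup_I)
    show "AE x in lebesgue_on G. ereal (l1_fun f x) \<le> 0"
      using f assms(1) by (subst AE_restrict_space_iff) (auto elim: eventually_mono)
  qed measurable
  then have "ess_sup_on G (resolvent D A \<mu> f) \<le> 0"
    using sup by (simp add: max_def split: if_splits)
  then have "AE x in lebesgue_on G. ereal (l1_fun (resolvent D A \<mu> f) x) \<le> 0"
    using esssup_AE[of "\<lambda>x. ereal (l1_fun (resolvent D A \<mu> f) x)" "lebesgue_on G"]
    unfolding ess_sup_on_def by (elim eventually_mono) (rule order_trans)
  then have "AE x in lebesgue. x \<in> G \<longrightarrow> l1_fun (resolvent D A \<mu> f) x \<le> 0"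
    using assms(1) by (subst (asm) AE_restrict_space_iff) (auto elim: eventually_mono)
  then show ?thesis
    using assms(3) unfolding l1_on_def mem_Collect_eq by eventually_elim auto
qed

text \<open>
  The Yosida approximations \<open>J \<mu> (A v) = (v - J \<mu> v) / \<mu>\<close> satisfy the inequality because \<open>J \<mu>\<close> is
  positive and contracting, and they tend to \<open>A v\<close> as \<open>\<mu>\<close> tends to \<open>0\<close>.
\<close>

lemma l1_pair_generator_nonneg:
  fixes A :: "'a::euclidean_space l1 \<Rightarrow> 'a l1"
  assumes G: "G \<in> sets lebesgue"
    and lin: "linear_operator_in (l1_on G) D A" and dense: "l1_on G \<subseteq> closure D"
    and res: "\<And>\<mu>. 0 < \<mu> \<Longrightarrow> bij_betw (\<lambda>v. v + \<mu> *\<^sub>R A v) D (l1_on G) \<and> 1-lipschitz_on (l1_on G) (resolvent D A \<mu>)"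
    and sup: "\<And>f \<mu>. f \<in> l1_on G \<Longrightarrow> 0 < \<mu> \<Longrightarrow> ess_sup_on G (resolvent D A \<mu> f) \<le> max (ess_sup_on G f) 0"
    and v: "v \<in> D"
    and g: "g \<in> borel_measurable lebesgue" "\<And>x. 0 \<le> g x" "\<And>x. g x \<le> 1"
    and sec: "AE x in lebesgue. (0 < l1_fun v x \<longrightarrow> g x = 1) \<and> (l1_fun v x < 0 \<longrightarrow> g x = 0)"
  shows "0 \<le> l1_pair g (A v)"
proof -
  have D: "subspace D" "D \<subseteq> l1_on G" "A ` D \<subseteq> l1_on G"
    and A_add: "\<And>v w. v \<in> D \<Longrightarrow> w \<in> D \<Longrightarrow> A (v + w) = A v + A w"
    and A_scale: "\<And>c v. v \<in> D \<Longrightarrow> A (c *\<^sub>R v) = c *\<^sub>R A v"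
    using lin unfolding linear_operator_in_def by auto
  have sub: "subspace (l1_on G)" by (rule subspace_l1_on)
  note pair = l1_pair_add[OF g] l1_pair_scaleR[OF g] l1_pair_diff[OF g]
  define J where "J \<mu> = resolvent D A \<mu>" for \<mu>
  have J: "J \<mu> (w + \<mu> *\<^sub>R A w) = w" if "0 < \<mu>" "w \<in> D" for \<mu> w
    using inv_into_f_f[OF bij_betw_imp_inj_on[OF conjunct1[OF res[OF that(1)]]] that(2)]
    by (simp add: J_def resolvent_def)
  have J_ex: "\<exists>w\<in>D. f = w + \<mu> *\<^sub>R A w \<and> J \<mu> f = w" if "0 < \<mu>" "f \<in> l1_on G" for \<mu> f
  proof -
    have "f \<in> (\<lambda>v. v + \<mu> *\<^sub>R A v) ` D"
      using res[OF that(1)] that(2) by (auto simp: bij_betw_def)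
    then show ?thesis using J[OF that(1)] by auto
  qed
  have J_D: "J \<mu> f \<in> D" if "0 < \<mu>" "f \<in> l1_on G" for \<mu> f
    using J_ex[OF that] by auto
  have J_add: "J \<mu> (f + h) = J \<mu> f + J \<mu> h" if fh: "0 < \<mu>" "f \<in> l1_on G" "h \<in> l1_on G" for \<mu> f h
  proof -
    obtain w where w: "w \<in> D" "f = w + \<mu> *\<^sub>R A w" "J \<mu> f = w" using J_ex[OF fh(1,2)] by auto
    obtain z where z: "z \<in> D" "h = z + \<mu> *\<^sub>R A z" "J \<mu> h = z" using J_ex[OF fh(1,3)] by auto
    have "f + h = (w + z) + \<mu> *\<^sub>R A (w + z)"
      using w z A_add by (simp add: algebra_simps)
    then show ?thesis
      using J[OF fh(1) subspace_add[OF D(1) w(1) z(1)]] w(3) z(3) by simp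
  qed
  have J_0: "J \<mu> 0 = 0" if \<mu>: "0 < \<mu>" for \<mu>
    using J[OF \<mu> subspace_0[OF D(1)]] A_scale[OF subspace_0[OF D(1)], of 0] by simp
  have J_dist: "norm (J \<mu> f - J \<mu> h) \<le> norm (f - h)" if "0 < \<mu>" "f \<in> l1_on G" "h \<in> l1_on G" for \<mu> f h
    using lipschitz_onD[of 1 "l1_on G" "resolvent D A \<mu>" f h] res[OF that(1)] that
    by (simp add: J_def dist_norm)
  have J_norm: "norm (J \<mu> f) \<le> norm f" if "0 < \<mu>" "f \<in> l1_on G" for \<mu> f
    using J_dist[OF that subspace_0[OF sub]] J_0[OF that(1)] by simp
  have vG: "v \<in> l1_on G" and AvG: "A v \<in> l1_on G" using v D by auto
  have J_A: "\<mu> *\<^sub>R J \<mu> (A w) = w - J \<mu> w" if w: "0 < \<mu>" "w \<in> D" for \<mu> w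
  proof -
    have wG: "w \<in> l1_on G" "A w \<in> l1_on G" using w D by auto
    \<comment> \<open>The candidate \<open>z\<close> equals \<open>A (J \<mu> w)\<close>. It lies in
      \<open>D\<close> as a combination of \<open>w\<close> and \<open>J \<mu> w\<close>, and
      \<open>z + \<mu> *\<^sub>R A z = A w\<close>; hence it is the resolvent of \<open>A w\<close>,
      and resolvent and generator commute.\<close>
    define z where "z = (1 / \<mu>) *\<^sub>R (w - J \<mu> w)"
    have Jw: "J \<mu> w \<in> D" by (rule J_D[OF w(1) wG(1)])
    obtain w' where w': "w' \<in> D" "w = w' + \<mu> *\<^sub>R A w'" "J \<mu> w = w'"
      using J_ex[OF w(1) wG(1)] by auto
    have m: "w - w' \<in> D" "- w' \<in> D"
      using w(2) w'(1) D(1) by (auto intro: subspace_diff subspace_neg)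
    have "A (- w') = - A w'" using A_scale[OF w'(1), of "- 1"] by simp
    then have "A (w - w') = A w - A w'"
      using A_add[OF w(2) m(2)] by simp
    then have "A z = (1 / \<mu>) *\<^sub>R (A w - A w')"
      using A_scale[OF m(1)] by (simp add: z_def w'(3))
    moreover have "w - w' = \<mu> *\<^sub>R A w'" using w'(2) by (simp add: algebra_simps)
    ultimately have "z + \<mu> *\<^sub>R A z = A w"
      using w(1) by (simp add: z_def w'(3))
    moreover have "z \<in> D" unfolding z_def w'(3) using m(1) D(1) by (rule subspace_scale[rotated])
    ultimately have "J \<mu> (A w) = z" using J[OF w(1), of z] by simp
    then show ?thesis using w(1) by (simp add: z_def)
  qed
  \<comment> \<open>Split \<open>v\<close> into \<open>l1_pos v\<close> and a nonpositive rest. By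
    contraction the image of the first pairs to at most \<open>norm (l1_pos v)\<close>, by
    positivity the image of the rest pairs to at most 0, while \<open>v\<close> itself pairs to
    exactly \<open>norm (l1_pos v)\<close>.\<close>
  have pos: "0 \<le> l1_pair g (J \<mu> (A v))" if \<mu>: "0 < \<mu>" for \<mu>
  proof -
    have pG: "l1_pos v \<in> l1_on G" "v - l1_pos v \<in> l1_on G"
      using l1_pos_in_l1_on[OF vG] subspace_diff[OF sub vG] by auto
    have "AE x in lebesgue. l1_fun (J \<mu> (v - l1_pos v)) x \<le> 0"
      unfolding J_def
      using J_D[OF \<mu> pG(2)] D(2) sup[OF pG(2) \<mu>]
      by (intro resolvent_nonpos[OF G pG(2)] l1_diff_pos_nonpos) (auto simp: J_def)
    then have "l1_pair g (J \<mu> (v - l1_pos v)) \<le> 0"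
      by (rule l1_pair_nonpos[OF g])
    moreover have "l1_pair g (J \<mu> (l1_pos v)) \<le> norm (l1_pos v)"
      using l1_pair_le_norm[OF g] J_norm[OF \<mu> pG(1)] by (rule order_trans)
    moreover have "J \<mu> v = J \<mu> (l1_pos v) + J \<mu> (v - l1_pos v)"
      using J_add[OF \<mu> pG] by simp
    ultimately have "l1_pair g (J \<mu> v) \<le> norm (l1_pos v)"
      by (simp add: pair)
    moreover have "l1_pair g v = norm (l1_pos v)"
      by (rule l1_pair_eq_pos[OF g sec])
    moreover have "\<mu> * l1_pair g (J \<mu> (A v)) = l1_pair g v - l1_pair g (J \<mu> v)"
      using J_A[OF \<mu> v] by (simp add: pair[symmetric])
    ultimately have "0 \<le> \<mu> * l1_pair g (J \<mu> (A v))" by simp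
    then show ?thesis using \<mu> by (simp add: zero_le_mult_iff)
  qed
  \<comment> \<open>Density yields \<open>d\<close> in \<open>D\<close> near \<open>A v\<close>, and
    \<open>J \<mu>\<close> moves \<open>d\<close> by at most \<open>\<mu> * norm (A d)\<close>. The
    error \<open>e\<close> consists of \<open>e / 4\<close> for each of the two exchanges of
    \<open>A v\<close> and \<open>d\<close>, and \<open>e / 2\<close> for this displacement. The 1
    in \<open>k\<close> admits \<open>A d = 0\<close>.\<close>
  have "- l1_pair g (A v) \<le> 0 + e" if "0 < e" for e
  proof -
    have "A v \<in> closure D" "0 < e / 4" using dense AvG that by auto
    then obtain d where d: "d \<in> D" "norm (d - A v) < e / 4"
      unfolding closure_approachable dist_norm by blast
    have dG: "d \<in> l1_on G" "A d \<in> l1_on G" using d D by auto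
    define k where "k = norm (A d) + 1"
    define \<mu> where "\<mu> = e / 2 / k"
    have n: "0 < k" using norm_ge_zero[of "A d"] unfolding k_def by linarith
    have \<mu>: "0 < \<mu>" using that n by (simp add: \<mu>_def)
    have "\<mu> * k = e / 2" using n by (simp add: \<mu>_def)
    then have \<mu>A: "\<mu> * norm (A d) \<le> e / 2" using \<mu> by (simp add: k_def algebra_simps)
    have "norm (d - J \<mu> d) = \<mu> * norm (J \<mu> (A d))"
      using J_A[OF \<mu> d(1)] \<mu> by (metis norm_scaleR abs_of_pos)
    also have "\<dots> \<le> e / 2"
      using mult_left_mono[OF J_norm[OF \<mu> dG(2)], of \<mu>] \<mu> \<mu>A by linarith
    finally have 1: "norm (d - J \<mu> d) \<le> e / 2" .
    have 2: "norm (J \<mu> d - J \<mu> (A v)) \<le> e / 4"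
      using J_dist[OF \<mu> dG(1) AvG] d(2) by simp
    have "J \<mu> (A v) - A v = (d - A v) - (d - J \<mu> d) - (J \<mu> d - J \<mu> (A v))" by simp
    also have "norm \<dots> \<le> norm (d - A v) + norm (d - J \<mu> d) + norm (J \<mu> d - J \<mu> (A v))"
      by (intro norm_triangle_ineq4[THEN order_trans] add_right_mono norm_triangle_ineq4)
    finally have "norm (J \<mu> (A v) - A v) \<le> e" using 1 2 d(2) by linarith
    then have "l1_pair g (J \<mu> (A v)) - l1_pair g (A v) \<le> e"
      using l1_pair_le_norm[OF g, of "J \<mu> (A v) - A v"] by (simp add: pair)
    then show ?thesis using pos[OF \<mu>] by simp
  qed
  then have "- l1_pair g (A v) \<le> 0" by (rule field_le_epsilon)
  then show ?thesis by simp
qed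

section \<open>Monotone graphs and the composite relation\<close>

text \<open>Test each subgradient inequality at the other point and add; the values of
  \<open>f\<close> cancel.\<close>

lemma subgradients_monotone:
  assumes "a \<in> subgradients (\<lambda>v. ereal (f v)) v" "b \<in> subgradients (\<lambda>v. ereal (f v)) w"
  shows "0 \<le> (a - b) * (v - w)"
proof -
  have "a * (w - v) \<le> f w - f v" "b * (v - w) \<le> f v - f w"
    using assms unfolding subgradients_def by auto
  then show ?thesis by (simp add: algebra_simps)
qed

text \<open>With \<open>u\<close> and \<open>v\<close> the differences of the two solution pairs,
  \<open>u + c *\<^sub>R A v\<close> is paired with a common section of sign^+ u and sign^+ v. The
  first summand gives \<open>norm (l1_pos u)\<close>, the second is nonnegative by
  \<open>l1_pair_generator_nonneg\<close>, and \<open>l1_pair_le_pos\<close> bounds the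
  whole.\<close>

lemma composite_relation_accretive:
  fixes A :: "'a::euclidean_space l1 \<Rightarrow> 'a l1"
  assumes G: "G \<in> sets lebesgue"
    and lin: "linear_operator_in (l1_on G) D A" and dense: "l1_on G \<subseteq> closure D"
    and res: "\<And>\<mu>. 0 < \<mu> \<Longrightarrow> bij_betw (\<lambda>v. v + \<mu> *\<^sub>R A v) D (l1_on G) \<and> 1-lipschitz_on (l1_on G) (resolvent D A \<mu>)"
    and sup: "\<And>f \<mu>. f \<in> l1_on G \<Longrightarrow> 0 < \<mu> \<Longrightarrow> ess_sup_on G (resolvent D A \<mu> f) \<le> max (ess_sup_on G f) 0"
    and mono: "\<And>x a b v w. x \<in> G \<Longrightarrow> a \<in> \<beta> x v \<Longrightarrow> b \<in> \<beta> x w \<Longrightarrow> 0 \<le> (a - b) * (v - w)"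
  shows "sublinear_functional.accretive (\<lambda>f. norm (l1_pos f)) (composite_relation G \<beta> D A)"
proof -
  interpret sublinear_functional "\<lambda>f :: 'a l1. norm (l1_pos f)"
    by (rule sublinear_norm_l1_pos)
  show ?thesis
    unfolding accretive_def
  proof (intro allI impI)
    fix u1 u2 f1 f2 :: "'a l1" and c :: real
    assume f1: "f1 \<in> composite_relation G \<beta> D A u1" and f2: "f2 \<in> composite_relation G \<beta> D A u2" and c: "0 < c"
    obtain v1 where v1: "v1 \<in> D" "A v1 = f1" "AE x in lebesgue_on G. l1_fun u1 x \<in> \<beta> x (l1_fun v1 x)"
      using f1 unfolding composite_relation_def by auto
    obtain v2 where v2: "v2 \<in> D" "A v2 = f2" "AE x in lebesgue_on G. l1_fun u2 x \<in> \<beta> x (l1_fun v2 x)"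
      using f2 unfolding composite_relation_def by auto
    have uG: "u1 \<in> l1_on G" "u2 \<in> l1_on G"
      using f1 f2 unfolding composite_relation_def by auto
    define v u where "v = v1 - v2" and "u = u1 - u2"
    have D: "subspace D" using lin by (simp add: linear_operator_in_def)
    have vD: "v \<in> D" unfolding v_def using D v1(1) v2(1) by (rule subspace_diff)
    have "- v2 \<in> D" using D v2(1) by (rule subspace_neg)
    moreover have "A (- v2) = - A v2"
      using lin v2(1) unfolding linear_operator_in_def by (metis scaleR_minus1_left)
    ultimately have "A (v1 + - v2) = A v1 + - A v2"
      using lin v1(1) unfolding linear_operator_in_def by metis
    then have Av: "A v = f1 - f2"
      using v1(2) v2(2) by (simp add: v_def)
    \<comment> \<open>On \<open>{v = 0}\<close> the section of \<open>sign\<^sup>+ v\<close> may be chosen freely, here so that it is also one of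
      \<open>sign\<^sup>+ u\<close>.\<close>
    define g where "g x = (if 0 < l1_fun v x \<or> l1_fun v x = 0 \<and> 0 < l1_fun u x then 1 else 0 :: real)" for x
    have g: "g \<in> borel_measurable lebesgue" "\<And>x. 0 \<le> g x" "\<And>x. g x \<le> 1"
      unfolding g_def by auto
    have "0 \<le> l1_pair g (A v)"
      by (rule l1_pair_generator_nonneg[OF G lin dense res sup vD g]) (auto simp: g_def)
    moreover have "l1_pair g u = norm (l1_pos u)"
    proof (rule l1_pair_eq_pos[OF g])
      have "(AE x in lebesgue_on G. P x) \<longleftrightarrow> (AE x in lebesgue. x \<in> G \<longrightarrow> P x)" for P
        using G by (subst AE_restrict_space_iff) auto
      then have "AE x in lebesgue. x \<in> G \<longrightarrow> l1_fun u1 x \<in> \<beta> x (l1_fun v1 x)"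
        "AE x in lebesgue. x \<in> G \<longrightarrow> l1_fun u2 x \<in> \<beta> x (l1_fun v2 x)"
        using v1(3) v2(3) by auto
      moreover have "AE x in lebesgue. x \<notin> G \<longrightarrow> l1_fun u1 x = 0" "AE x in lebesgue. x \<notin> G \<longrightarrow> l1_fun u2 x = 0"
        using uG by (auto simp: l1_on_def)
      ultimately show "AE x in lebesgue. (0 < l1_fun u x \<longrightarrow> g x = 1) \<and> (l1_fun u x < 0 \<longrightarrow> g x = 0)"
        using l1_fun_diff[of u1 u2] l1_fun_diff[of v1 v2]
      proof eventually_elim
        case (elim x)
        \<comment> \<open>On \<open>G\<close> monotonicity excludes opposite strict signs of
          \<open>u\<close> and \<open>v\<close>. Off \<open>G\<close> the function \<open>u\<close>
          vanishes and both implications are void.\<close>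
        have "0 \<le> l1_fun u x * l1_fun v x" if "x \<in> G"
          using mono[OF that, of "l1_fun u1 x" "l1_fun v1 x" "l1_fun u2 x" "l1_fun v2 x"] elim that
          by (simp add: u_def v_def)
        moreover have "l1_fun u x = 0" if "x \<notin> G"
          using elim that by (simp add: u_def)
        ultimately show ?case
          by (cases "x \<in> G") (auto simp: g_def zero_le_mult_iff)
      qed
    qed
    moreover have "l1_pair g (u + c *\<^sub>R A v) = l1_pair g u + c * l1_pair g (A v)"
      by (simp add: l1_pair_add[OF g] l1_pair_scaleR[OF g])
    ultimately have "norm (l1_pos u) \<le> l1_pair g (u + c *\<^sub>R A v)"
      using c by simp
    also have "\<dots> \<le> norm (l1_pos (u + c *\<^sub>R A v))"
      by (rule l1_pair_le_pos[OF g])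
    finally show "norm (l1_pos (u1 - u2)) \<le> norm (l1_pos (u1 - u2 + c *\<^sub>R (f1 - f2)))"
      by (simp add: u_def Av)
  qed
qed

section \<open>The estimates for the positive part, the negative part and the norm\<close>

theorem corollary4p10:
  fixes G :: "(real ^ 'n) set" and T :: real
    and \<phi> :: "real ^ 'n \<Rightarrow> real \<Rightarrow> real"
    and \<beta> :: "real ^ 'n \<Rightarrow> real \<Rightarrow> real set"
    and D :: "(real ^ 'n) l1 set" and A :: "(real ^ 'n) l1 \<Rightarrow> (real ^ 'n) l1"
    and \<A> :: "(real ^ 'n) l1 \<Rightarrow> (real ^ 'n) l1 set"
    and F\<^sub>1 F\<^sub>2 u\<^sub>1 u\<^sub>2 :: "real \<Rightarrow> (real ^ 'n) l1"
  assumes "bounded G" and "open G" and "T > 0"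
    and "\<forall>x\<in>G. \<forall>v. 0 \<le> \<phi> x v"
    and "measurable_convex_integrand G (\<lambda>x v. ereal (\<phi> x v))"
    and "\<forall>x\<in>G. \<phi> x 0 = 0"
    and "\<beta> = (\<lambda>x. subgradients (\<lambda>v. ereal (\<phi> x v)))"
    and "\<forall>C>0. square_integrable_on G (\<lambda>x. subgradient_bound (\<lambda>v. ereal (\<phi> x v)) C)"
    and "linear_operator_in (l1_on G) D A"
    and "l1_on G \<subseteq> closure D"
    and "\<forall>\<mu>>0. bij_betw (\<lambda>v. v + \<mu> *\<^sub>R A v) D (l1_on G) \<and> 1-lipschitz_on (l1_on G) (resolvent D A \<mu>)"
    and "\<exists>c>0. \<forall>v\<in>D. c * norm v \<le> norm (A v)"
    and "\<forall>f\<in>l1_on G. \<forall>\<mu>>0. ess_sup_on G (resolvent D A \<mu> f) \<le> max (ess_sup_on G f) 0"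
    and "\<A> = composite_relation G \<beta> D A"
    and "bochner_L1 (l1_on G) T F\<^sub>1" and "bochner_L1 (l1_on G) T F\<^sub>2"
    and "u\<^sub>1 0 \<in> closure {u. \<A> u \<noteq> {}}" and "u\<^sub>2 0 \<in> closure {u. \<A> u \<noteq> {}}"
    and "C0_solution (l1_on G) \<A> F\<^sub>1 T (u\<^sub>1 0) u\<^sub>1"
    and "C0_solution (l1_on G) \<A> F\<^sub>2 T (u\<^sub>2 0) u\<^sub>2"
  shows "\<forall>t\<in>{0..T}.
      norm (l1_pos (u\<^sub>1 t - u\<^sub>2 t)) \<le> norm (l1_pos (u\<^sub>1 0 - u\<^sub>2 0))
        + (\<integral>s. norm (l1_pos (F\<^sub>1 s - F\<^sub>2 s)) \<partial>lebesgue_on {0<..<t}) \<and>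
      norm (l1_neg (u\<^sub>1 t - u\<^sub>2 t)) \<le> norm (l1_neg (u\<^sub>1 0 - u\<^sub>2 0))
        + (\<integral>s. norm (l1_neg (F\<^sub>1 s - F\<^sub>2 s)) \<partial>lebesgue_on {0<..<t}) \<and>
      norm (u\<^sub>1 t - u\<^sub>2 t) \<le> norm (u\<^sub>1 0 - u\<^sub>2 0)
        + (\<integral>s. norm (F\<^sub>1 s - F\<^sub>2 s) \<partial>lebesgue_on {0<..<t})"
proof -
  have G: "G \<in> sets lebesgue"
    using assms(2) by (simp add: borel_open)
  have acc: "sublinear_functional.accretive (\<lambda>f. norm (l1_pos f)) \<A>"
    unfolding assms(14)
  proof (rule composite_relation_accretive[OF G assms(9,10)])
    show "bij_betw (\<lambda>v. v + \<mu> *\<^sub>R A v) D (l1_on G) \<and> 1-lipschitz_on (l1_on G) (resolvent D A \<mu>)"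
      if "0 < \<mu>" for \<mu>
      using assms(11) that by blast
    show "ess_sup_on G (resolvent D A \<mu> f) \<le> max (ess_sup_on G f) 0"
      if "f \<in> l1_on G" "0 < \<mu>" for f \<mu>
      using assms(13) that by blast
    show "0 \<le> (a - b) * (v - w)" if "a \<in> \<beta> x v" "b \<in> \<beta> x w" for x a b v w
      using that subgradients_monotone unfolding assms(7) by blast
  qed
  interpret sublinear_functional "\<lambda>f :: (real ^ 'n) l1. norm (l1_pos f)"
    by (rule sublinear_norm_l1_pos)
  have F: "integrable (lebesgue_on {0<..<T}) F\<^sub>1" "integrable (lebesgue_on {0<..<T}) F\<^sub>2"
    using assms(15,16) by (auto simp: bochner_L1_def)
  show ?thesis
  proof
    fix t assume t: "t \<in> {0..T}"
    have Ft: "integrable (lebesgue_on {0<..<t}) F\<^sub>1" "integrable (lebesgue_on {0<..<t}) F\<^sub>2"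
      using t by (auto intro!: integrable_lebesgue_on_subset[OF F(1)] integrable_lebesgue_on_subset[OF F(2)])
    have neg: "l1_neg (f - h) = l1_pos (h - f)" for f h :: "(real ^ 'n) l1"
      by (simp add: l1_neg_eq)
    have pos_le: "norm (l1_pos (u\<^sub>1 t - u\<^sub>2 t)) \<le> norm (l1_pos (u\<^sub>1 0 - u\<^sub>2 0))
        + (\<integral>s. norm (l1_pos (F\<^sub>1 s - F\<^sub>2 s)) \<partial>lebesgue_on {0<..<t})"
      by (rule accretive_C0_solutions_le[OF acc assms(19,20) F t])
    have neg_le: "norm (l1_neg (u\<^sub>1 t - u\<^sub>2 t)) \<le> norm (l1_neg (u\<^sub>1 0 - u\<^sub>2 0))
        + (\<integral>s. norm (l1_neg (F\<^sub>1 s - F\<^sub>2 s)) \<partial>lebesgue_on {0<..<t})"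
      unfolding neg by (rule accretive_C0_solutions_le[OF acc assms(20,19) F(2,1) t])
    \<comment> \<open>The L^1 norm is additive on positive and negative parts. Both are integrable
      in time, so the two one-sided bounds add up to the third one.\<close>
    have "(\<integral>s. norm (F\<^sub>1 s - F\<^sub>2 s) \<partial>lebesgue_on {0<..<t})
        = (\<integral>s. norm (l1_pos (F\<^sub>1 s - F\<^sub>2 s)) \<partial>lebesgue_on {0<..<t})
        + (\<integral>s. norm (l1_neg (F\<^sub>1 s - F\<^sub>2 s)) \<partial>lebesgue_on {0<..<t})"
      unfolding norm_eq_pos_neg[of "F\<^sub>1 _ - F\<^sub>2 _"] neg
      by (intro Bochner_Integration.integral_add integrable_comp_diff Ft)
    then show "norm (l1_pos (u\<^sub>1 t - u\<^sub>2 t)) \<le> norm (l1_pos (u\<^sub>1 0 - u\<^sub>2 0))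
        + (\<integral>s. norm (l1_pos (F\<^sub>1 s - F\<^sub>2 s)) \<partial>lebesgue_on {0<..<t}) \<and>
      norm (l1_neg (u\<^sub>1 t - u\<^sub>2 t)) \<le> norm (l1_neg (u\<^sub>1 0 - u\<^sub>2 0))
        + (\<integral>s. norm (l1_neg (F\<^sub>1 s - F\<^sub>2 s)) \<partial>lebesgue_on {0<..<t}) \<and>
      norm (u\<^sub>1 t - u\<^sub>2 t) \<le> norm (u\<^sub>1 0 - u\<^sub>2 0)
        + (\<integral>s. norm (F\<^sub>1 s - F\<^sub>2 s) \<partial>lebesgue_on {0<..<t})"
      using pos_le neg_le norm_eq_pos_neg[of "u\<^sub>1 t - u\<^sub>2 t"] norm_eq_pos_neg[of "u\<^sub>1 0 - u\<^sub>2 0"] by linarith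
  qed
qed

end
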